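(* Let $\mathbb{X}\subset\mathbb{R}^d$ be compact and consider a zero mean Gaussian process defined through a continuous covariance kernel $k(\cdot,\cdot)$ with Lipschitz constant $L_k$ on $\mathbb{X}$. Consider an infinite data stream of observations $(\bm{x}_i,y_i)$, $i\in\mathbb{N}$, $\bm{x}_i\in\mathbb{X}$, of an unknown function $f:\mathbb{X}\to\mathbb{R}$ with Lipschitz constant $L_f$ and maximum absolute value $\bar f\in\mathbb{R}_+$ on $\mathbb{X}$, such that $f$ is a sample from the Gaussian process $\mathcal{GP}(0,k(\bm{x},\bm{x}'))$ and $y_i=f(\bm{x}_i)+\epsilon_i$ with i.i.d. zero mean Gaussian noise $\epsilon_i$ of variance $\sigma_n^2$. Let $\nu_N(\cdot)$ and $\sigma_N(\cdot)$ denote the mean and standard deviation of the Gaussian process conditioned on the first $N$ observations. If there exists an $\epsilon>0$ such that the standard deviation satisfies $$\sigma_N(\bm{x})\in\mathcal{O}\left(\log(N)^{-\frac12-\epsilon}\right),\quad\forall\bm{x}\in\mathbb{X},$$ then for every $\delta\in(0,1)$ it holds that $$P\left(\sup_{\bm{x}\in\mathbb{X}}|\nu_N(\bm{x})-f(\bm{x})|\in\mathcal{O}\left(\log(N)^{-\epsilon}\right)\right)\ge1-\delta.$$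
   Context: Notation. $\mathbb{R}_+$ denotes the positive reals, $\|\cdot\|$ the Euclidean norm, $\bm{I}_N$ the $N\times N$ identity. Big $\mathcal{O}$ refers to the limit $N\to\infty$. Covariance kernels are functions $k:\mathbb{R}^d\times\mathbb{R}^d\to\mathbb{R}_+$, and $\sigma_n^2\ge0$. Gaussian process regression. $\bm{X}_N$ collects the input points $\bm{x}_1,\dots,\bm{x}_N$ and $\bm{y}_N=(y_1,\dots,y_N)^{\top}$. $\bm{K}(\bm{X}_N,\bm{X}_N)$ is the $N\times N$ matrix with entries $k(\bm{x}_i,\bm{x}_j)$; $\bm{k}(\bm{x},\bm{X}_N)$ is the row vector with entries $k(\bm{x},\bm{x}_i)$ and $\bm{k}(\bm{X}_N,\bm{x})$ its transpose. The matrix $\bm{K}(\bm{X}_N,\bm{X}_N)+\sigma_n^2\bm{I}_N$ is understood to be invertible. The posterior mean and variance are $$\nu_N(\bm{x})=\bm{k}(\bm{x},\bm{X}_N)(\bm{K}(\bm{X}_N,\bm{X}_N)+\sigma_n^2\bm{I}_N)^{-1}\bm{y}_N,$$ $$\sigma_N^2(\bm{x})=k(\bm{x},\bm{x})-\bm{k}(\bm{x},\bm{X}_N)(\bm{K}(\bm{X}_N,\bm{X}_N)+\sigma_n^2\bm{I}_N)^{-1}\bm{k}(\bm{X}_N,\bm{x}),$$ and $\sigma_N(\bm{x})=\sqrt{\sigma_N^2(\bm{x})}$. The noise is independent of $f$; probability is with respect to the Gaussian process distribution of $f$ and the noise. $L_f$ and $\bar f$ are a Lipschitz constant and a bound of the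 realized function $f$. Lipschitz constant of the kernel: $|k(\bm{x},\bm{z})-k(\bm{x}',\bm{z})|\le L_k\|\bm{x}-\bm{x}'\|$ for all $\bm{x},\bm{x}',\bm{z}\in\mathbb{X}$; for a differentiable kernel it is taken to be $L_k=\max_{\bm{x},\bm{x}'\in\mathbb{X}}\big\|\big[\tfrac{\partial k(\bm{x},\bm{x}')}{\partial x_1},\dots,\tfrac{\partial k(\bm{x},\bm{x}')}{\partial x_d}\big]^{\top}\big\|$.
   Formalization: The condition on the standard deviation is required uniformly on 𝕏, i.e. sup over x of σ_N(x) is O(log(N)^(-1/2-ε)), instead of separately for each x ∈ 𝕏; with constants depending on x the claim is false. *)

theory Defs
  imports "HOL-Probability.Probability" "Jordan_Normal_Form.Gauss_Jordan_Elimination"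
begin

text \<open>Gaussian laws on the real line. A zero standard deviation gives the Dirac law: noise-free
  observations and linearly dependent values of a Gaussian process are allowed.\<close>

definition gaussian_measure :: "real \<Rightarrow> real \<Rightarrow> real measure" where
  "gaussian_measure \<mu> \<sigma> =
     (if \<sigma> = 0 then return borel \<mu> else density lborel (normal_density \<mu> \<sigma>))"

text \<open>A finite family of random variables is jointly Gaussian (possibly degenerate) when each of
  its linear combinations is Gaussian on the real line. Only the variables indexed by \<open>X\<close> are
  constrained.\<close>

definition gaussian_process ::
  "'w measure \<Rightarrow> 'a set \<Rightarrow> ('a \<Rightarrow> real) \<Rightarrow> ('a \<Rightarrow> 'a \<Rightarrow> real) \<Rightarrow> ('w \<Rightarrow> 'a \<Rightarrow> real) \<Rightarrow> bool" where
  "gaussian_process M X m k f \<longleftrightarrow>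
     (\<forall>x\<in>X. (\<lambda>\<omega>. f \<omega> x) \<in> borel_measurable M) \<and>
     (\<forall>S c. finite S \<and> S \<subseteq> X \<longrightarrow>
        (\<exists>\<mu> \<sigma>. 0 \<le> \<sigma> \<and> distr M borel (\<lambda>\<omega>. \<Sum>x\<in>S. c x * f \<omega> x) = gaussian_measure \<mu> \<sigma>)) \<and>
     (\<forall>x\<in>X. (LINT \<omega>|M. f \<omega> x) = m x) \<and>
     (\<forall>x\<in>X. \<forall>x'\<in>X. (LINT \<omega>|M. (f \<omega> x - m x) * (f \<omega> x' - m x')) = k x x')"

text \<open>The sequence \<open>xs\<close> of inputs is indexed from 0, so the first \<open>N\<close> inputs are those with
  index \<open>i < N\<close>. The parameter \<open>\<sigma>\<^sub>n\<close> is the standard deviation of the noise.\<close>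

definition noisy_gram :: "('a \<Rightarrow> 'a \<Rightarrow> real) \<Rightarrow> real \<Rightarrow> (nat \<Rightarrow> 'a) \<Rightarrow> nat \<Rightarrow> real mat" where
  "noisy_gram k \<sigma>\<^sub>n xs N =
     mat N N (\<lambda>(i, j). k (xs i) (xs j)) + \<sigma>\<^sub>n\<^sup>2 \<cdot>\<^sub>m 1\<^sub>m N"

definition kernel_vec :: "('a \<Rightarrow> 'a \<Rightarrow> real) \<Rightarrow> (nat \<Rightarrow> 'a) \<Rightarrow> nat \<Rightarrow> 'a \<Rightarrow> real Matrix.vec" where
  "kernel_vec k xs N x = Matrix.vec N (\<lambda>i. k x (xs i))"

text \<open>The value \<open>the (mat_inverse A)\<close> is the inverse of \<open>A\<close> only if \<open>A\<close> is invertible.\<close>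

definition posterior_mean ::
  "('a \<Rightarrow> 'a \<Rightarrow> real) \<Rightarrow> real \<Rightarrow> (nat \<Rightarrow> 'a) \<Rightarrow> (nat \<Rightarrow> real) \<Rightarrow> nat \<Rightarrow> 'a \<Rightarrow> real" where
  "posterior_mean k \<sigma>\<^sub>n xs ys N x =
     scalar_prod (kernel_vec k xs N x)
       (the (mat_inverse (noisy_gram k \<sigma>\<^sub>n xs N)) *\<^sub>v Matrix.vec N ys)"

definition posterior_variance ::
  "('a \<Rightarrow> 'a \<Rightarrow> real) \<Rightarrow> real \<Rightarrow> (nat \<Rightarrow> 'a) \<Rightarrow> nat \<Rightarrow> 'a \<Rightarrow> real" where
  "posterior_variance k \<sigma>\<^sub>n xs N x =
     k x x - scalar_prod (kernel_vec k xs N x)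
       (the (mat_inverse (noisy_gram k \<sigma>\<^sub>n xs N)) *\<^sub>v kernel_vec k xs N x)"

definition posterior_sd ::
  "('a \<Rightarrow> 'a \<Rightarrow> real) \<Rightarrow> real \<Rightarrow> (nat \<Rightarrow> 'a) \<Rightarrow> nat \<Rightarrow> 'a \<Rightarrow> real" where
  "posterior_sd k \<sigma>\<^sub>n xs N x = sqrt (posterior_variance k \<sigma>\<^sub>n xs N x)"

end

theory Submission
  imports Defs "HOL-Real_Asymp.Real_Asymp"
begin

text \<open>The posterior error \<open>\<nu>\<^sub>N - f\<close> is a centred Gaussian process with variance \<open>\<sigma>\<^sub>N\<^sup>2\<close>. The
  posterior mean is an orthogonal projection, so the increments of the error over \<open>x, x'\<close> have variance
  at most \<open>k x x - 2 k x x' + k x' x' \<le> 2 L\<^sub>k dist x x'\<close>, uniformly in \<open>N\<close> and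
  without any bound on the inverse Gram matrix, so that \<open>\<sigma>\<^sub>n = 0\<close> is harmless. Chaining along dyadic nets
  from a net of mesh about \<open>1 / N\<close> downwards therefore costs only a negative power of \<open>N\<close>, by
  Borel--Cantelli, while on that net, which has polynomially many points, a union bound gives
  \<open>O(\<sigma>\<^sub>N sqrt (ln N))\<close>. Hence the rate holds almost surely.\<close>

text \<open>A pathwise Lipschitz constant for the posterior mean would involve the inverse Gram
  matrix applied to the data, and nothing bounds that when \<open>\<sigma>\<^sub>n = 0\<close>. The
  Lipschitz property of the sample paths therefore supplies the continuity that lets chains of net
  points converge, while every quantitative estimate is probabilistic. The mesh 1 / N is a
  compromise: the net has so few points that the logarithm of their number is O(ln N), and it is so
  fine that everything below it is smaller than any power of ln N. The chain has to be controlled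
  for all large N simultaneously. Level j is visited only by those N with
  \<open>N \<le> 2 ^ j\<close>, so the number of bad events per level grows geometrically, whereas
  each has probability at most 2 exp(- c (9/8)^j). Borel--Cantelli can thus run over the levels. The
  rate hypothesis is uniform over \<open>X\<close>: the net points move with N, so the union bound
  needs one constant for all of them.\<close>

section \<open>Gaussian moment generating functions\<close>

text \<open>The centred Gaussian law is recorded through its moment generating function, which is
  all that a Chernoff bound consumes. It multiplies under independence, so sums of process and noise
  need no convolution of densities, and variance 0 is no exception.\<close>

definition has_gaussian_mgf :: "'w measure \<Rightarrow> ('w \<Rightarrow> real) \<Rightarrow> real \<Rightarrow> bool" where
  "has_gaussian_mgf M Y v \<longleftrightarrow>
     Y \<in> borel_measurable M \<and>
     (\<forall>l. has_bochner_integral M (\<lambda>\<omega>. exp (l * Y \<omega>)) (exp (l\<^sup>2 * v / 2)))"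

lemma has_bochner_integral_return:
  fixes g :: "'a \<Rightarrow> real"
  assumes "g \<in> borel_measurable N" "x \<in> space N"
  shows "has_bochner_integral (return N x) g (g x)"
proof -
  have "integrable (return N x) g"
  proof (rule integrableI_bounded)
    show "g \<in> borel_measurable (return N x)"
      using assms by simp
    have "(\<integral>\<^sup>+ y. ennreal (norm (g y)) \<partial>return N x) = ennreal (norm (g x))"
      using assms by (intro nn_integral_return) simp_all
    then show "(\<integral>\<^sup>+ y. ennreal (norm (g y)) \<partial>return N x) < \<infinity>"
      by simp
  qed
  then show ?thesis
    using assms by (simp add: has_bochner_integral_iff integral_return)
qed

lemma gaussian_measure_moments:
  assumes "0 \<le> \<sigma>"
  shows gaussian_measure_mgf:
      "has_bochner_integral (gaussian_measure \<mu> \<sigma>) (\<lambda>x. exp (l * x)) (exp (l * \<mu> + l\<^sup>2 * \<sigma>\<^sup>2 / 2))"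
    and gaussian_measure_mean: "has_bochner_integral (gaussian_measure \<mu> \<sigma>) (\<lambda>x. x) \<mu>"
    and gaussian_measure_variance:
      "has_bochner_integral (gaussian_measure \<mu> \<sigma>) (\<lambda>x. (x - \<mu>)\<^sup>2) (\<sigma>\<^sup>2)"
proof -
  consider "\<sigma> = 0" | "0 < \<sigma>" using assms by (auto simp: less_le)
  then have "has_bochner_integral (gaussian_measure \<mu> \<sigma>) (\<lambda>x. exp (l * x)) (exp (l * \<mu> + l\<^sup>2 * \<sigma>\<^sup>2 / 2)) \<and>
    has_bochner_integral (gaussian_measure \<mu> \<sigma>) (\<lambda>x. x) \<mu> \<and>
    has_bochner_integral (gaussian_measure \<mu> \<sigma>) (\<lambda>x. (x - \<mu>)\<^sup>2) (\<sigma>\<^sup>2)"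
  proof cases
    case 1
    have *: "has_bochner_integral (gaussian_measure \<mu> \<sigma>) g (g \<mu>)" if "g \<in> borel_measurable borel" for g :: "real \<Rightarrow> real"
      using 1 that by (simp add: gaussian_measure_def has_bochner_integral_return)
    have "has_bochner_integral (gaussian_measure \<mu> \<sigma>) (\<lambda>x. exp (l * x)) (exp (l * \<mu>))"
      by (rule *) measurable
    moreover have "has_bochner_integral (gaussian_measure \<mu> \<sigma>) (\<lambda>x. x) \<mu>"
      by (rule *) measurable
    moreover have "has_bochner_integral (gaussian_measure \<mu> \<sigma>) (\<lambda>x. (x - \<mu>)\<^sup>2) ((\<mu> - \<mu>)\<^sup>2)"
      by (rule *) measurable
    ultimately show ?thesis
      using 1 by simp
  next
    case 2
    \<comment> \<open>Exponential tilting: completing the square shows that the factor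
      \<open>exp (l * x)\<close> shifts the mean by \<open>l * \<sigma>\<^sup>2\<close> and keeps
      the variance. The constant left over is the moment generating function.\<close>
    have "normal_density \<mu> \<sigma> x * exp (l * x)
        = exp (l * \<mu> + l\<^sup>2 * \<sigma>\<^sup>2 / 2) * normal_density (\<mu> + l * \<sigma>\<^sup>2) \<sigma> x" for x
    proof -
      have "(x - (\<mu> + l * \<sigma>\<^sup>2))\<^sup>2 = (x - \<mu>)\<^sup>2 - (2 * \<sigma>\<^sup>2) * (l * (x - \<mu>) - l\<^sup>2 * \<sigma>\<^sup>2 / 2)"
        by (simp add: power2_eq_square algebra_simps)
      then have "(x - (\<mu> + l * \<sigma>\<^sup>2))\<^sup>2 / (2 * \<sigma>\<^sup>2)
          = (x - \<mu>)\<^sup>2 / (2 * \<sigma>\<^sup>2) - (l * (x - \<mu>) - l\<^sup>2 * \<sigma>\<^sup>2 / 2)"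
        using 2 by (simp only: diff_divide_distrib) simp
      then have "exp (- (x - \<mu>)\<^sup>2 / (2 * \<sigma>\<^sup>2)) * exp (l * x)
          = exp (l * \<mu> + l\<^sup>2 * \<sigma>\<^sup>2 / 2) * exp (- (x - (\<mu> + l * \<sigma>\<^sup>2))\<^sup>2 / (2 * \<sigma>\<^sup>2))"
        unfolding exp_add[symmetric] minus_divide_left[symmetric] by (simp add: right_diff_distrib)
      then show ?thesis
        unfolding normal_density_def by (simp only: mult.assoc mult.left_commute)
    qed
    moreover have "has_bochner_integral lborel (normal_density (\<mu> + l * \<sigma>\<^sup>2) \<sigma>) 1"
      using 2 by (simp add: has_bochner_integral_iff)
    ultimately have mgf: "has_bochner_integral lborel (\<lambda>x. normal_density \<mu> \<sigma> x * exp (l * x))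
        (exp (l * \<mu> + l\<^sup>2 * \<sigma>\<^sup>2 / 2))"
      using has_bochner_integral_mult_right[of "exp (l * \<mu> + l\<^sup>2 * \<sigma>\<^sup>2 / 2)" lborel
          "normal_density (\<mu> + l * \<sigma>\<^sup>2) \<sigma>" 1] by simp
    have *: "has_bochner_integral (gaussian_measure \<mu> \<sigma>) g I"
      if "has_bochner_integral lborel (\<lambda>x. normal_density \<mu> \<sigma> x * g x) I" "g \<in> borel_measurable borel"
      for g :: "real \<Rightarrow> real" and I
      using that 2 unfolding gaussian_measure_def
      by (simp add: has_bochner_integral_density normal_density_nonneg)
    have "has_bochner_integral (gaussian_measure \<mu> \<sigma>) (\<lambda>x. exp (l * x)) (exp (l * \<mu> + l\<^sup>2 * \<sigma>\<^sup>2 / 2))"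
      by (rule *[OF mgf]) measurable
    moreover have "has_bochner_integral (gaussian_measure \<mu> \<sigma>) (\<lambda>x. x) \<mu>"
      by (rule *[OF normal_moment_nz_1[OF 2]]) measurable
    moreover have "has_bochner_integral (gaussian_measure \<mu> \<sigma>) (\<lambda>x. (x - \<mu>)\<^sup>2) (\<sigma>\<^sup>2)"
      using normal_moment_even[OF 2, of \<mu> 1] by (intro *) simp_all
    ultimately show ?thesis
      by (intro conjI)
  qed
  then show "has_bochner_integral (gaussian_measure \<mu> \<sigma>) (\<lambda>x. exp (l * x)) (exp (l * \<mu> + l\<^sup>2 * \<sigma>\<^sup>2 / 2))"
    "has_bochner_integral (gaussian_measure \<mu> \<sigma>) (\<lambda>x. x) \<mu>"
    "has_bochner_integral (gaussian_measure \<mu> \<sigma>) (\<lambda>x. (x - \<mu>)\<^sup>2) (\<sigma>\<^sup>2)"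
    by - (elim conjE, assumption)+
qed

lemma has_gaussian_mgf_distr:
  assumes Y: "Y \<in> borel_measurable M" and "0 \<le> \<sigma>" and "distr M borel Y = gaussian_measure 0 \<sigma>"
  shows "has_gaussian_mgf M Y (\<sigma>\<^sup>2)"
  unfolding has_gaussian_mgf_def
proof (intro conjI allI)
  fix l
  show "has_bochner_integral M (\<lambda>\<omega>. exp (l * Y \<omega>)) (exp (l\<^sup>2 * \<sigma>\<^sup>2 / 2))"
    using gaussian_measure_mgf[OF \<open>0 \<le> \<sigma>\<close>, of 0 l] Y
    by (simp add: has_bochner_integral_iff integrable_distr_eq integral_distr flip: assms(3))
qed fact

lemma has_gaussian_mgf_uminus:
  assumes "has_gaussian_mgf M Y v"
  shows "has_gaussian_mgf M (\<lambda>\<omega>. - Y \<omega>) v"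
  unfolding has_gaussian_mgf_def
proof (intro conjI allI)
  show "(\<lambda>\<omega>. - Y \<omega>) \<in> borel_measurable M"
    using assms by (auto simp: has_gaussian_mgf_def)
  fix l :: real
  have "has_bochner_integral M (\<lambda>\<omega>. exp (- l * Y \<omega>)) (exp ((- l)\<^sup>2 * v / 2))"
    using assms unfolding has_gaussian_mgf_def by blast
  then show "has_bochner_integral M (\<lambda>\<omega>. exp (l * - Y \<omega>)) (exp (l\<^sup>2 * v / 2))"
    by simp
qed

context prob_space
begin

text \<open>Chernoff bound. A number \<open>s > 0\<close> above the variance takes its place, so
  that \<open>v = 0\<close> needs no separate treatment and variance estimates can be inserted
  directly.\<close>

lemma has_gaussian_mgf_upper_tail:
  assumes Y: "has_gaussian_mgf M Y v" and "v \<le> s" "0 < s" "0 \<le> t"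
  shows "prob {\<omega> \<in> space M. t \<le> Y \<omega>} \<le> exp (- t\<^sup>2 / (2 * s))"
proof (cases "t = 0")
  case False
  \<comment> \<open>The minimiser of \<open>- l * t + l\<^sup>2 * s / 2\<close>. It is positive, as
    the Chernoff inequality requires, because \<open>t = 0\<close> is split off; there the bound is
    1.\<close>
  define l where "l = t / s"
  have [measurable]: "Y \<in> borel_measurable M"
    and int: "has_bochner_integral M (\<lambda>\<omega>. exp (l * Y \<omega>)) (exp (l\<^sup>2 * v / 2))"
    using Y by (auto simp: has_gaussian_mgf_def)
  have "0 < l" using False assms by (simp add: l_def)
  have "emeasure M {\<omega> \<in> space M. t \<le> Y \<omega>} \<le>
      ennreal (exp (- l * t)) * (\<integral>\<^sup>+\<omega>. ennreal (exp (l * Y \<omega>)) * indicator (space M) \<omega> \<partial>M)"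
    using \<open>0 < l\<close> by (intro Chernoff_ineq_nn_integral_ge) auto
  also have "(\<integral>\<^sup>+\<omega>. ennreal (exp (l * Y \<omega>)) * indicator (space M) \<omega> \<partial>M) = ennreal (exp (l\<^sup>2 * v / 2))"
    using nn_integral_eq_integral[of M "\<lambda>\<omega>. exp (l * Y \<omega>)"] int
    by (simp add: has_bochner_integral_iff cong: nn_integral_cong)
  also have "ennreal (exp (- l * t)) * ennreal (exp (l\<^sup>2 * v / 2)) = ennreal (exp (- l * t + l\<^sup>2 * v / 2))"
    by (simp add: mult_exp_exp flip: ennreal_mult)
  also have "\<dots> \<le> ennreal (exp (- t\<^sup>2 / (2 * s)))"
  proof -
    have "l\<^sup>2 * v / 2 \<le> l\<^sup>2 * s / 2" using \<open>v \<le> s\<close> by (simp add: mult_left_mono)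
    also have "\<dots> = l * t - t\<^sup>2 / (2 * s)"
      using \<open>0 < s\<close> by (simp add: l_def field_simps power2_eq_square)
    finally show ?thesis by (intro ennreal_leI) simp
  qed
  finally show ?thesis
    by (simp add: emeasure_eq_measure)
qed simp

lemma has_gaussian_mgf_tail:
  assumes Y: "has_gaussian_mgf M Y v" and "v \<le> s" "0 < s" "0 \<le> t"
  shows "prob {\<omega> \<in> space M. t \<le> \<bar>Y \<omega>\<bar>} \<le> 2 * exp (- t\<^sup>2 / (2 * s))"
proof -
  have [measurable]: "Y \<in> borel_measurable M"
    using Y by (auto simp: has_gaussian_mgf_def)
  have "{\<omega> \<in> space M. t \<le> \<bar>Y \<omega>\<bar>} = {\<omega> \<in> space M. t \<le> Y \<omega>} \<union> {\<omega> \<in> space M. t \<le> - Y \<omega>}"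
    by auto
  also have "prob \<dots> \<le> prob {\<omega> \<in> space M. t \<le> Y \<omega>} + prob {\<omega> \<in> space M. t \<le> - Y \<omega>}"
    by (intro measure_Un_le) auto
  also have "\<dots> \<le> exp (- t\<^sup>2 / (2 * s)) + exp (- t\<^sup>2 / (2 * s))"
    by (intro add_mono has_gaussian_mgf_upper_tail[OF Y] assms
        has_gaussian_mgf_upper_tail[OF has_gaussian_mgf_uminus[OF Y]])
  finally show ?thesis by simp
qed

lemma has_gaussian_mgf_add:
  assumes "indep_var borel Y borel Z" "has_gaussian_mgf M Y v" "has_gaussian_mgf M Z w"
  shows "has_gaussian_mgf M (\<lambda>\<omega>. Y \<omega> + Z \<omega>) (v + w)"
  unfolding has_gaussian_mgf_def
proof (intro conjI allI)
  show "(\<lambda>\<omega>. Y \<omega> + Z \<omega>) \<in> borel_measurable M"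
    using assms by (auto simp: has_gaussian_mgf_def)
  fix l :: real
  have "indep_var borel ((\<lambda>x. exp (l * x)) \<circ> Y) borel ((\<lambda>x. exp (l * x)) \<circ> Z)"
    by (rule indep_var_compose[OF assms(1)]) auto
  from indep_var_lebesgue_integral[OF this] indep_var_integrable[OF this] assms(2,3)
  show "has_bochner_integral M (\<lambda>\<omega>. exp (l * (Y \<omega> + Z \<omega>))) (exp (l\<^sup>2 * (v + w) / 2))"
    by (simp add: has_gaussian_mgf_def has_bochner_integral_iff comp_def distrib_left exp_add add_divide_distrib)
qed

lemma has_gaussian_mgf_sum:
  assumes "indep_vars (\<lambda>_. borel) Y I" "finite I" "\<And>i. i \<in> I \<Longrightarrow> has_gaussian_mgf M (Y i) (v i)"
  shows "has_gaussian_mgf M (\<lambda>\<omega>. \<Sum>i\<in>I. c i * Y i \<omega>) (\<Sum>i\<in>I. (c i)\<^sup>2 * v i)"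
  unfolding has_gaussian_mgf_def
proof (intro conjI allI)
  show "(\<lambda>\<omega>. \<Sum>i\<in>I. c i * Y i \<omega>) \<in> borel_measurable M"
    using assms(3) unfolding has_gaussian_mgf_def by (intro borel_measurable_sum borel_measurable_times) auto
  fix l :: real
  have ind: "indep_vars (\<lambda>_. borel) (\<lambda>i \<omega>. exp (l * c i * Y i \<omega>)) I"
    by (rule indep_vars_compose2[OF assms(1)]) auto
  have each: "has_bochner_integral M (\<lambda>\<omega>. exp (l * c i * Y i \<omega>)) (exp ((l * c i)\<^sup>2 * v i / 2))"
    if "i \<in> I" for i
    using assms(3)[OF that] unfolding has_gaussian_mgf_def by blast
  have "has_bochner_integral M (\<lambda>\<omega>. \<Prod>i\<in>I. exp (l * c i * Y i \<omega>)) (\<Prod>i\<in>I. exp ((l * c i)\<^sup>2 * v i / 2))"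
    using indep_vars_lebesgue_integral[OF assms(2) ind] indep_vars_integrable[OF assms(2) ind] each
    by (simp add: has_bochner_integral_iff)
  then show "has_bochner_integral M (\<lambda>\<omega>. exp (l * (\<Sum>i\<in>I. c i * Y i \<omega>)))
      (exp (l\<^sup>2 * (\<Sum>i\<in>I. (c i)\<^sup>2 * v i) / 2))"
    by (simp add: assms(2) sum_distrib_left sum_divide_distrib power_mult_distrib mult_ac flip: exp_sum)
qed

end

section \<open>Linear combinations of a Gaussian process\<close>

context prob_space
begin

text \<open>The moment clauses of \<open>gaussian_process\<close> do not entail integrability, since
  the integral of a non-integrable function is 0 by default. It comes from the Gaussian law of the
  one-point combinations.\<close>

lemma gaussian_process_integrable:
  assumes gp: "gaussian_process M X m k f" and "x \<in> X"
  shows "integrable M (\<lambda>\<omega>. f \<omega> x)" "integrable M (\<lambda>\<omega>. (f \<omega> x)\<^sup>2)"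
proof -
  have [measurable]: "(\<lambda>\<omega>. f \<omega> x) \<in> borel_measurable M"
    using gp \<open>x \<in> X\<close> by (simp add: gaussian_process_def)
  have "\<exists>\<mu> \<sigma>. 0 \<le> \<sigma> \<and> distr M borel (\<lambda>\<omega>. \<Sum>x\<in>{x}. 1 * f \<omega> x) = gaussian_measure \<mu> \<sigma>"
    using gp \<open>x \<in> X\<close> unfolding gaussian_process_def
    by (elim conjE) (drule spec[of _ "{x}"], drule spec[of _ "\<lambda>_. 1"], simp)
  then obtain \<mu> \<sigma> where "0 \<le> \<sigma>" and d: "distr M borel (\<lambda>\<omega>. f \<omega> x) = gaussian_measure \<mu> \<sigma>"
    by auto
  have int: "integrable M (\<lambda>\<omega>. g (f \<omega> x))"
    if "has_bochner_integral (gaussian_measure \<mu> \<sigma>) g I" "g \<in> borel_measurable borel" for g :: "real \<Rightarrow> real" and I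
    using that by (simp add: has_bochner_integral_iff integrable_distr_eq flip: d)
  show 1: "integrable M (\<lambda>\<omega>. f \<omega> x)"
    by (rule int[OF gaussian_measure_mean[OF \<open>0 \<le> \<sigma>\<close>]]) simp
  have "integrable M (\<lambda>\<omega>. (f \<omega> x - \<mu>)\<^sup>2)"
    by (rule int[OF gaussian_measure_variance[OF \<open>0 \<le> \<sigma>\<close>]]) simp
  with 1 have "integrable M (\<lambda>\<omega>. (f \<omega> x - \<mu>)\<^sup>2 + (2 * \<mu> * f \<omega> x - \<mu>\<^sup>2))"
    by (intro Bochner_Integration.integrable_add Bochner_Integration.integrable_diff) simp_all
  moreover have "(f \<omega> x - \<mu>)\<^sup>2 + (2 * \<mu> * f \<omega> x - \<mu>\<^sup>2) = (f \<omega> x)\<^sup>2" for \<omega>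
    by (simp add: power2_eq_square algebra_simps)
  ultimately show "integrable M (\<lambda>\<omega>. (f \<omega> x)\<^sup>2)"
    by simp
qed

lemma integrable_mult_of_square_integrable:
  fixes g h :: "'a \<Rightarrow> real"
  assumes [measurable]: "g \<in> borel_measurable M" "h \<in> borel_measurable M"
    and "integrable M (\<lambda>\<omega>. (g \<omega>)\<^sup>2)" "integrable M (\<lambda>\<omega>. (h \<omega>)\<^sup>2)"
  shows "integrable M (\<lambda>\<omega>. g \<omega> * h \<omega>)"
proof (rule Bochner_Integration.integrable_bound)
  show "integrable M (\<lambda>\<omega>. (g \<omega>)\<^sup>2 + (h \<omega>)\<^sup>2)"
    using assms(3,4) by simp
  have "\<bar>a * b\<bar> \<le> a\<^sup>2 + b\<^sup>2" for a b :: real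
  proof -
    have "2 * (\<bar>a\<bar> * \<bar>b\<bar>) \<le> a\<^sup>2 + b\<^sup>2"
      using sum_squares_bound[of "\<bar>a\<bar>" "\<bar>b\<bar>"] by (simp add: mult.assoc)
    then show ?thesis
      using mult_nonneg_nonneg[of "\<bar>a\<bar>" "\<bar>b\<bar>"] by (simp only: abs_mult) linarith
  qed
  then show "AE \<omega> in M. norm (g \<omega> * h \<omega>) \<le> norm ((g \<omega>)\<^sup>2 + (h \<omega>)\<^sup>2)"
    by simp
qed simp

text \<open>The definition of a Gaussian process provides some Gaussian law for each combination;
  its parameters are identified here through the first two moments. Since the double sum is a
  variance, \<open>k\<close> is positive semidefinite. The family \<open>u\<close> may repeat
  points, as the inputs may.\<close>

lemma gaussian_process_linear_combination:
  assumes gp: "gaussian_process M X (\<lambda>_. 0) k f" and "finite I" and u: "\<And>i. i \<in> I \<Longrightarrow> u i \<in> X"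
  shows "has_gaussian_mgf M (\<lambda>\<omega>. \<Sum>i\<in>I. c i * f \<omega> (u i)) (\<Sum>i\<in>I. \<Sum>j\<in>I. c i * c j * k (u i) (u j))"
    and "0 \<le> (\<Sum>i\<in>I. \<Sum>j\<in>I. c i * c j * k (u i) (u j))"
proof -
  define W where "W \<omega> = (\<Sum>i\<in>I. c i * f \<omega> (u i))" for \<omega>
  have meas: "(\<lambda>\<omega>. f \<omega> (u i)) \<in> borel_measurable M" if "i \<in> I" for i
    using gp u[OF that] by (simp add: gaussian_process_def)
  then have W[measurable]: "W \<in> borel_measurable M"
    unfolding W_def[abs_def] by (intro borel_measurable_sum borel_measurable_times) auto
  \<comment> \<open>\<open>gaussian_process\<close> speaks of sets of points, so the coefficients of
    coinciding points are merged.\<close>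
  define d where "d x = (\<Sum>i\<in>{i \<in> I. u i = x}. c i)" for x
  have W_eq: "W = (\<lambda>\<omega>. \<Sum>x\<in>u ` I. d x * f \<omega> x)"
  proof
    fix \<omega>
    have "W \<omega> = (\<Sum>x\<in>u ` I. \<Sum>i\<in>{i \<in> I. u i = x}. c i * f \<omega> (u i))"
      unfolding W_def by (rule sum.image_gen[OF \<open>finite I\<close>])
    also have "\<dots> = (\<Sum>x\<in>u ` I. d x * f \<omega> x)"
      unfolding d_def sum_distrib_right by (intro sum.cong) auto
    finally show "W \<omega> = (\<Sum>x\<in>u ` I. d x * f \<omega> x)" .
  qed
  have "finite (u ` I)" "u ` I \<subseteq> X"
    using u \<open>finite I\<close> by auto
  then have "\<exists>\<mu> \<sigma>. 0 \<le> \<sigma> \<and> distr M borel (\<lambda>\<omega>. \<Sum>x\<in>u ` I. d x * f \<omega> x) = gaussian_measure \<mu> \<sigma>"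
    using gp unfolding gaussian_process_def by blast
  then obtain \<mu> \<sigma> where "0 \<le> \<sigma>" and d: "distr M borel W = gaussian_measure \<mu> \<sigma>"
    unfolding W_eq by blast
  have expect: "integrable M (\<lambda>\<omega>. g (W \<omega>)) \<and> expectation (\<lambda>\<omega>. g (W \<omega>)) = I"
    if "has_bochner_integral (gaussian_measure \<mu> \<sigma>) g I" "g \<in> borel_measurable borel" for g :: "real \<Rightarrow> real" and I
    using that by (simp add: has_bochner_integral_iff integrable_distr_eq integral_distr flip: d)
  have "expectation W = (\<Sum>i\<in>I. c i * expectation (\<lambda>\<omega>. f \<omega> (u i)))"
    unfolding W_def[abs_def] using gaussian_process_integrable(1)[OF gp u]
    by (simp add: Bochner_Integration.integral_sum)
  also have "\<dots> = 0"
    using gp u by (simp add: gaussian_process_def)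
  finally have "\<mu> = 0"
    using expect[OF gaussian_measure_mean[OF \<open>0 \<le> \<sigma>\<close>]] by simp
  have prod: "integrable M (\<lambda>\<omega>. f \<omega> (u i) * f \<omega> (u j))" if "i \<in> I" "j \<in> I" for i j
    using that by (intro integrable_mult_of_square_integrable meas gaussian_process_integrable(2)[OF gp u])
  have "\<sigma>\<^sup>2 = expectation (\<lambda>\<omega>. (W \<omega>)\<^sup>2)"
    using expect[OF gaussian_measure_variance[OF \<open>0 \<le> \<sigma>\<close>]] \<open>\<mu> = 0\<close> by simp
  also have "(\<lambda>\<omega>. (W \<omega>)\<^sup>2) = (\<lambda>\<omega>. \<Sum>i\<in>I. \<Sum>j\<in>I. c i * c j * (f \<omega> (u i) * f \<omega> (u j)))"
    by (simp add: W_def power2_eq_square sum_product mult_ac)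
  also have "expectation \<dots> = (\<Sum>i\<in>I. \<Sum>j\<in>I. c i * c j * expectation (\<lambda>\<omega>. f \<omega> (u i) * f \<omega> (u j)))"
    using prod by (simp add: Bochner_Integration.integral_sum)
  also have "\<dots> = (\<Sum>i\<in>I. \<Sum>j\<in>I. c i * c j * k (u i) (u j))"
    using gp u by (intro sum.cong refl) (simp add: gaussian_process_def)
  finally have var: "\<sigma>\<^sup>2 = (\<Sum>i\<in>I. \<Sum>j\<in>I. c i * c j * k (u i) (u j))" .
  show "has_gaussian_mgf M (\<lambda>\<omega>. \<Sum>i\<in>I. c i * f \<omega> (u i)) (\<Sum>i\<in>I. \<Sum>j\<in>I. c i * c j * k (u i) (u j))"
    using has_gaussian_mgf_distr[OF W \<open>0 \<le> \<sigma>\<close>] d \<open>\<mu> = 0\<close> by (simp add: var W_def[abs_def])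
  show "0 \<le> (\<Sum>i\<in>I. \<Sum>j\<in>I. c i * c j * k (u i) (u j))"
    by (simp flip: var)
qed

end

text \<open>The weights \<open>\<beta> x\<close> solve the normal equations: they are the inverse
  Gram matrix applied to the kernel vector at \<open>x\<close>. Applying the inverse to the data
  instead gives the last form of the mean, a combination of kernel sections with coefficients
  independent of \<open>x\<close>, from which continuity can be read off.\<close>

lemma posterior_weights:
  assumes inv: "invertible_mat (noisy_gram k \<sigma> xs N)"
    and sym: "\<And>i j. i < N \<Longrightarrow> j < N \<Longrightarrow> k (xs i) (xs j) = k (xs j) (xs i)"
  obtains \<beta> where
    "\<And>x i. i < N \<Longrightarrow> (\<Sum>j<N. k (xs i) (xs j) * \<beta> x j) + \<sigma>\<^sup>2 * \<beta> x i = k x (xs i)"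
    "\<And>x ys. posterior_mean k \<sigma> xs ys N x = (\<Sum>i<N. \<beta> x i * ys i)"
    "\<And>x. posterior_variance k \<sigma> xs N x = k x x - (\<Sum>i<N. \<beta> x i * k x (xs i))"
    "\<And>ys. \<exists>w. \<forall>x. posterior_mean k \<sigma> xs ys N x = (\<Sum>i<N. w i * k x (xs i))"
proof -
  define G where "G = noisy_gram k \<sigma> xs N"
  define B where "B = the (mat_inverse G)"
  define \<beta> where "\<beta> x i = vec_index (B *\<^sub>v kernel_vec k xs N x) i" for x i
  have G: "G \<in> carrier_mat N N"
    by (simp add: G_def noisy_gram_def)
  have kv: "kernel_vec k xs N x \<in> carrier_vec N" for x
    by (simp add: kernel_vec_def)
  obtain B' where B': "G * B' = 1\<^sub>m N" "B' * G = 1\<^sub>m (dim_row B')"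
    using inv G unfolding G_def[symmetric] invertible_mat_def inverts_mat_def by auto
  have "dim_col B' = N"
    using arg_cong[OF B'(1), of dim_col] by simp
  moreover have "dim_row B' = N"
    using arg_cong[OF B'(2), of dim_col] G by simp
  ultimately have B'N: "B' \<in> carrier_mat N N"
    by (rule carrier_matI[rotated])
  \<comment> \<open>\<open>invertible_mat\<close> asserts only that some inverse exists. Being a
    unit of the matrix ring excludes the outcome \<open>None\<close> of \<open>mat_inverse\<close>,
    so that \<open>the\<close> returns a genuine inverse.\<close>
  have "G \<in> Units (ring_mat TYPE(real) N ())"
    unfolding Units_def ring_mat_def using B' B'N G by auto
  then obtain B0 where "mat_inverse G = Some B0"
    using mat_inverse(1)[OF G, of "()"] by (cases "mat_inverse G") auto
  then have GB: "G * B = 1\<^sub>m N" and B: "B \<in> carrier_mat N N"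
    using mat_inverse(2)[OF G] by (auto simp: B_def)
  have GT: "transpose_mat G = G"
    using G sym by (intro eq_matI) (auto simp: G_def noisy_gram_def)
  have Bkv: "B *\<^sub>v kernel_vec k xs N x \<in> carrier_vec N" for x
    using B kv by simp
  have sol: "G *\<^sub>v (B *\<^sub>v v) = v" if "v \<in> carrier_vec N" for v
    using that G B GB by (simp flip: assoc_mult_mat_vec)
  have Gv: "vec_index (G *\<^sub>v v) i
      = (\<Sum>j<N. (k (xs i) (xs j) + (if i = j then \<sigma>\<^sup>2 else 0)) * vec_index v j)"
    if "i < N" "v \<in> carrier_vec N" for v i
    using that by (auto simp: scalar_prod_def G_def noisy_gram_def atLeast0LessThan intro!: sum.cong)
  \<comment> \<open>The kernel vector is written as \<open>G\<close> applied to its solution; the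
    symmetric \<open>G\<close> then moves across the product and cancels the \<open>B\<close> on the
    right.\<close>
  have mean: "scalar_prod (kernel_vec k xs N x) (B *\<^sub>v v) = (\<Sum>i<N. \<beta> x i * vec_index v i)"
    if v: "v \<in> carrier_vec N" for x v
  proof -
    have "scalar_prod (kernel_vec k xs N x) (B *\<^sub>v v)
        = scalar_prod (transpose_mat G *\<^sub>v (B *\<^sub>v kernel_vec k xs N x)) (B *\<^sub>v v)"
      by (simp add: GT sol kv)
    also have "\<dots> = scalar_prod (B *\<^sub>v kernel_vec k xs N x) (G *\<^sub>v (B *\<^sub>v v))"
      using G B v Bkv by (intro transpose_vec_mult_scalar) auto
    also have "\<dots> = (\<Sum>i<N. \<beta> x i * vec_index v i)"
      using v by (simp add: sol scalar_prod_def \<beta>_def atLeast0LessThan)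
    finally show ?thesis .
  qed
  show thesis
  proof (rule that)
    fix x i assume "i < N"
    have "k x (xs i) = vec_index (G *\<^sub>v (B *\<^sub>v kernel_vec k xs N x)) i"
      using \<open>i < N\<close> by (simp add: sol kv) (simp add: kernel_vec_def)
    also have "\<dots> = (\<Sum>j<N. (k (xs i) (xs j) + (if i = j then \<sigma>\<^sup>2 else 0)) * \<beta> x j)"
      unfolding \<beta>_def using Gv[OF \<open>i < N\<close> Bkv] .
    also have "\<dots> = (\<Sum>j<N. k (xs i) (xs j) * \<beta> x j) + (\<Sum>j<N. if i = j then \<sigma>\<^sup>2 * \<beta> x j else 0)"
      unfolding sum.distrib[symmetric] by (intro sum.cong) (auto simp: distrib_right)
    also have "\<dots> = (\<Sum>j<N. k (xs i) (xs j) * \<beta> x j) + \<sigma>\<^sup>2 * \<beta> x i"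
      using \<open>i < N\<close> by simp
    finally show "(\<Sum>j<N. k (xs i) (xs j) * \<beta> x j) + \<sigma>\<^sup>2 * \<beta> x i = k x (xs i)" by simp
  next
    fix x ys
    show "posterior_mean k \<sigma> xs ys N x = (\<Sum>i<N. \<beta> x i * ys i)"
      using mean[of "Matrix.vec N ys" x] by (simp add: posterior_mean_def B_def G_def)
  next
    fix x
    show "posterior_variance k \<sigma> xs N x = k x x - (\<Sum>i<N. \<beta> x i * k x (xs i))"
      using mean[OF kv[of x], of x] by (simp add: posterior_variance_def B_def G_def kernel_vec_def)
  next
    fix ys
    have "posterior_mean k \<sigma> xs ys N x
        = (\<Sum>i<N. vec_index (B *\<^sub>v Matrix.vec N ys) i * k x (xs i))" for x
      using B by (simp add: posterior_mean_def scalar_prod_def kernel_vec_def mult.commute atLeast0LessThan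
          flip: B_def G_def)
    then show "\<exists>w. \<forall>x. posterior_mean k \<sigma> xs ys N x = (\<Sum>i<N. w i * k x (xs i))"
      by blast
  qed
qed

section \<open>The posterior error\<close>

locale gp_regression = prob_space M for M :: "'w measure" +
  fixes X :: "'a set" and k :: "'a \<Rightarrow> 'a \<Rightarrow> real" and \<sigma> :: real and f :: "'w \<Rightarrow> 'a \<Rightarrow> real"
    and xs :: "nat \<Rightarrow> 'a" and noise :: "nat \<Rightarrow> 'w \<Rightarrow> real"
  assumes gp: "gaussian_process M X (\<lambda>_. 0) k f"
    and noise_sd: "0 \<le> \<sigma>"
    and noise_indep: "indep_vars (\<lambda>_. borel) noise UNIV"
    and noise_distr: "\<And>i. distr M borel (noise i) = gaussian_measure 0 \<sigma>"
    and process_noise_indep: "indep_set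
          (sets (vimage_algebra (space M) (\<lambda>\<omega>. \<lambda>x\<in>X. f \<omega> x) (\<Pi>\<^sub>M x\<in>X. borel)))
          (sets (vimage_algebra (space M) (\<lambda>\<omega> i. noise i \<omega>) (\<Pi>\<^sub>M i\<in>UNIV. borel)))"
    and inputs: "\<And>i. xs i \<in> X"
    and gram_invertible: "\<And>N. invertible_mat (noisy_gram k \<sigma> xs N)"
begin

definition posterior_error :: "nat \<Rightarrow> 'w \<Rightarrow> 'a \<Rightarrow> real" where
  "posterior_error N \<omega> x =
     posterior_mean k \<sigma> xs (\<lambda>i. f \<omega> (xs i) + noise i \<omega>) N x - f \<omega> x"

lemma noise_measurable [measurable]: "noise i \<in> borel_measurable M"
  using noise_indep by (simp add: indep_vars_def)

lemma process_measurable: "x \<in> X \<Longrightarrow> (\<lambda>\<omega>. f \<omega> x) \<in> borel_measurable M"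
  using gp by (simp add: gaussian_process_def)

lemma kernel_sym:
  assumes "x \<in> X" "x' \<in> X"
  shows "k x x' = k x' x"
proof -
  have "k x x' = (LINT \<omega>|M. f \<omega> x * f \<omega> x')" "k x' x = (LINT \<omega>|M. f \<omega> x' * f \<omega> x)"
    using gp assms by (simp_all add: gaussian_process_def)
  then show ?thesis
    by (simp add: mult.commute)
qed

text \<open>Each combination is measurable for the sigma-algebra generated by the whole process or
  the whole noise sequence, and independence passes to smaller sigma-algebras.\<close>

lemma indep_process_noise_combination:
  assumes u: "\<And>i. i \<in> I \<Longrightarrow> u i \<in> X"
  shows "indep_var borel (\<lambda>\<omega>. \<Sum>i\<in>I. c i * f \<omega> (u i)) borel (\<lambda>\<omega>. \<Sum>i\<in>J. d i * noise i \<omega>)"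
proof -
  let ?F = "\<lambda>\<omega>. \<lambda>x\<in>X. f \<omega> x" and ?N = "\<lambda>\<omega> i. noise i \<omega>"
  let ?Y = "\<lambda>\<omega>. \<Sum>i\<in>I. c i * f \<omega> (u i)" and ?W = "\<lambda>\<omega>. \<Sum>i\<in>J. d i * noise i \<omega>"
  define F where "F = vimage_algebra (space M) ?F (\<Pi>\<^sub>M x\<in>X. borel)"
  define G where "G = vimage_algebra (space M) ?N (\<Pi>\<^sub>M i\<in>UNIV. borel)"
  have space: "space F = space M" "space G = space M"
    by (simp_all add: F_def G_def)
  have "?F \<in> F \<rightarrow>\<^sub>M (\<Pi>\<^sub>M x\<in>X. borel)"
    unfolding F_def by (rule measurable_vimage_algebra1) (auto simp: space_PiM)
  from measurable_compose[OF this measurable_component_singleton]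
  have f: "(\<lambda>\<omega>. f \<omega> x) \<in> borel_measurable F" if "x \<in> X" for x
    using that by fastforce
  have Y: "?Y \<in> borel_measurable F"
    by (intro borel_measurable_sum borel_measurable_times borel_measurable_const f u)
  have "?N \<in> G \<rightarrow>\<^sub>M (\<Pi>\<^sub>M i\<in>UNIV. borel)"
    unfolding G_def by (rule measurable_vimage_algebra1) (auto simp: space_PiM)
  from measurable_compose[OF this measurable_component_singleton]
  have W: "?W \<in> borel_measurable G"
    by (intro borel_measurable_sum borel_measurable_times borel_measurable_const) auto
  have subset: "sigma_sets (space M) {h -` A \<inter> space M |A. A \<in> sets borel} \<subseteq> sets H"
    if "h \<in> borel_measurable H" "space H = space M" for h :: "'w \<Rightarrow> real" and H
    using sets.sigma_sets_subset[of "{h -` A \<inter> space M |A. A \<in> sets borel}" H] that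
      measurable_sets[OF that(1)] by auto
  have indep: "indep_set (sets F) (sets G)"
    using process_noise_indep by (simp add: F_def G_def)
  have "indep_set (sigma_sets (space M) {?Y -` A \<inter> space M |A. A \<in> sets borel})
      (sigma_sets (space M) {?W -` A \<inter> space M |A. A \<in> sets borel})"
    using subset[OF Y space(1)] subset[OF W space(2)]
      indep_setD_ev1[OF indep] indep_setD_ev2[OF indep] indep_setD[OF indep]
    by (intro indep_setI) blast+
  moreover have "?Y \<in> borel_measurable M"
    using u by (intro borel_measurable_sum borel_measurable_times borel_measurable_const process_measurable)
  ultimately show ?thesis
    by (simp add: indep_var_eq)
qed

text \<open>One computation for two uses: \<open>\<theta> = 0\<close> gives the error at
  \<open>x\<close>, \<open>\<theta> = 1\<close> the increment between \<open>x\<close> and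
  \<open>x'\<close>. In \<open>v\<close> the prior variance of the target is reduced by the part
  that the data explain; the last claim says that this part is never negative.\<close>

lemma residual_has_gaussian_mgf:
  assumes x: "x \<in> X" "x' \<in> X"
    and normal_eq: "\<And>i. i < N \<Longrightarrow>
      (\<Sum>j<N. k (xs i) (xs j) * \<beta> j) + \<sigma>\<^sup>2 * \<beta> i = k x (xs i) - \<theta> * k x' (xs i)"
  defines "v \<equiv> k x x - 2 * \<theta> * k x x' + \<theta>\<^sup>2 * k x' x'
      - (\<Sum>i<N. \<beta> i * (k x (xs i) - \<theta> * k x' (xs i)))"
  shows "has_gaussian_mgf M (\<lambda>\<omega>. (\<Sum>i<N. \<beta> i * (f \<omega> (xs i) + noise i \<omega>)) - (f \<omega> x - \<theta> * f \<omega> x')) v"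
    and "0 \<le> v"
    and "0 \<le> (\<Sum>i<N. \<beta> i * (k x (xs i) - \<theta> * k x' (xs i)))"
proof -
  \<comment> \<open>The indices \<open>N\<close> and \<open>N + 1\<close> carry \<open>x\<close> and
    \<open>x'\<close>, with coefficients -1 and \<open>\<theta>\<close>, so that the noise-free part
    of the residual is a single combination of process values.\<close>
  define u where "u i = (if i < N then xs i else if i = N then x else x')" for i
  define c where "c i = (if i < N then \<beta> i else if i = N then - 1 else \<theta>)" for i
  define I where "I = {..<Suc (Suc N)}"
  have u: "u i \<in> X" for i
    using x inputs by (simp add: u_def)
  have sum_I: "(\<Sum>i\<in>I. c i * h (u i)) = (\<Sum>i<N. \<beta> i * h (xs i)) - h x + \<theta> * h x'" for h
    by (simp add: I_def u_def c_def)
  define vf where "vf = (\<Sum>i\<in>I. \<Sum>j\<in>I. c i * c j * k (u i) (u j))"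
  have "vf = (\<Sum>i\<in>I. c i * (\<Sum>j\<in>I. c j * k (u i) (u j)))"
    unfolding vf_def by (simp add: sum_distrib_left mult.assoc)
  also have "\<dots> = (\<Sum>i\<in>I. c i * ((\<Sum>j<N. \<beta> j * k (u i) (xs j)) - k (u i) x + \<theta> * k (u i) x'))"
    by (simp only: sum_I)
  also have "\<dots> = (\<Sum>i<N. \<beta> i * ((\<Sum>j<N. \<beta> j * k (xs i) (xs j)) - k (xs i) x + \<theta> * k (xs i) x'))
      - ((\<Sum>j<N. \<beta> j * k x (xs j)) - k x x + \<theta> * k x x')
      + \<theta> * ((\<Sum>j<N. \<beta> j * k x' (xs j)) - k x' x + \<theta> * k x' x')"
    by (rule sum_I)
  \<comment> \<open>By the normal equations the row of an input collapses to minus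
    \<open>\<sigma>\<^sup>2\<close> times its weight. The resulting deficit is exactly the variance
    that the noise adds back.\<close>
  also have "(\<Sum>i<N. \<beta> i * ((\<Sum>j<N. \<beta> j * k (xs i) (xs j)) - k (xs i) x + \<theta> * k (xs i) x'))
      = (\<Sum>i<N. - ((\<beta> i)\<^sup>2 * \<sigma>\<^sup>2))"
  proof (intro sum.cong refl)
    fix i assume "i \<in> {..<N}"
    then have "(\<Sum>j<N. \<beta> j * k (xs i) (xs j)) - k (xs i) x + \<theta> * k (xs i) x' = - (\<sigma>\<^sup>2 * \<beta> i)"
      using normal_eq[of i] kernel_sym[OF inputs x(1), of i] kernel_sym[OF inputs x(2), of i]
      by (simp add: mult.commute)
    then show "\<beta> i * ((\<Sum>j<N. \<beta> j * k (xs i) (xs j)) - k (xs i) x + \<theta> * k (xs i) x')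
        = - ((\<beta> i)\<^sup>2 * \<sigma>\<^sup>2)"
      by (simp add: power2_eq_square)
  qed
  finally have "vf = - (\<Sum>i<N. (\<beta> i)\<^sup>2 * \<sigma>\<^sup>2)
      - ((\<Sum>j<N. \<beta> j * k x (xs j)) - \<theta> * (\<Sum>j<N. \<beta> j * k x' (xs j)))
      + (k x x - 2 * \<theta> * k x x' + \<theta>\<^sup>2 * k x' x')"
    using kernel_sym[OF x] by (simp add: sum_negf power2_eq_square algebra_simps)
  also have "(\<Sum>j<N. \<beta> j * k x (xs j)) - \<theta> * (\<Sum>j<N. \<beta> j * k x' (xs j))
      = (\<Sum>i<N. \<beta> i * (k x (xs i) - \<theta> * k x' (xs i)))"
    by (simp add: sum_distrib_left right_diff_distrib sum_subtractf mult.left_commute)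
  finally have v: "v = vf + (\<Sum>i<N. (\<beta> i)\<^sup>2 * \<sigma>\<^sup>2)"
    by (simp add: v_def)
  have process: "has_gaussian_mgf M (\<lambda>\<omega>. \<Sum>i\<in>I. c i * f \<omega> (u i)) vf" and "0 \<le> vf"
    unfolding vf_def using gaussian_process_linear_combination[OF gp, of I u c] u by (auto simp: I_def)
  have noise: "has_gaussian_mgf M (\<lambda>\<omega>. \<Sum>i<N. \<beta> i * noise i \<omega>) (\<Sum>i<N. (\<beta> i)\<^sup>2 * \<sigma>\<^sup>2)"
    by (intro has_gaussian_mgf_sum has_gaussian_mgf_distr noise_measurable noise_sd noise_distr
        indep_vars_subset[OF noise_indep] finite_lessThan subset_UNIV)
  have "has_gaussian_mgf M (\<lambda>\<omega>. (\<Sum>i\<in>I. c i * f \<omega> (u i)) + (\<Sum>i<N. \<beta> i * noise i \<omega>)) v"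
    unfolding v by (intro has_gaussian_mgf_add process noise indep_process_noise_combination u)
  moreover have "(\<lambda>\<omega>. (\<Sum>i\<in>I. c i * f \<omega> (u i)) + (\<Sum>i<N. \<beta> i * noise i \<omega>))
      = (\<lambda>\<omega>. (\<Sum>i<N. \<beta> i * (f \<omega> (xs i) + noise i \<omega>)) - (f \<omega> x - \<theta> * f \<omega> x'))"
    by (simp add: sum_I fun_eq_iff distrib_left sum.distrib)
  ultimately show "has_gaussian_mgf M (\<lambda>\<omega>. (\<Sum>i<N. \<beta> i * (f \<omega> (xs i) + noise i \<omega>)) - (f \<omega> x - \<theta> * f \<omega> x')) v"
    by simp
  show "0 \<le> v"
    unfolding v using \<open>0 \<le> vf\<close> by (intro add_nonneg_nonneg sum_nonneg) auto
  \<comment> \<open>The explained variance is the quadratic form of the noisy Gram matrix at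
    \<open>\<beta>\<close>.\<close>
  have "(\<Sum>i<N. \<beta> i * (k x (xs i) - \<theta> * k x' (xs i)))
      = (\<Sum>i<N. \<beta> i * ((\<Sum>j<N. k (xs i) (xs j) * \<beta> j) + \<sigma>\<^sup>2 * \<beta> i))"
    by (intro sum.cong refl) (simp add: normal_eq)
  also have "\<dots> = (\<Sum>i<N. \<Sum>j<N. \<beta> i * \<beta> j * k (xs i) (xs j)) + (\<Sum>i<N. \<sigma>\<^sup>2 * (\<beta> i)\<^sup>2)"
    by (simp add: distrib_left sum.distrib sum_distrib_left power2_eq_square mult_ac)
  also have "0 \<le> \<dots>"
    using gaussian_process_linear_combination(2)[OF gp, of "{..<N}" xs \<beta>] inputs
    by (intro add_nonneg_nonneg) (auto intro: sum_nonneg)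
  finally show "0 \<le> (\<Sum>i<N. \<beta> i * (k x (xs i) - \<theta> * k x' (xs i)))" .
qed

text \<open>The residual with \<open>\<theta> = 0\<close>, where \<open>x\<close> also fills the
  place of the second point. The comparison with the prior variance will make the posterior standard
  deviation bounded on \<open>X\<close>, so that its supremum is a true upper bound.\<close>

lemma posterior_error_has_gaussian_mgf:
  assumes x: "x \<in> X"
  shows "has_gaussian_mgf M (\<lambda>\<omega>. posterior_error N \<omega> x) (posterior_variance k \<sigma> xs N x)"
    and posterior_variance_nonneg: "0 \<le> posterior_variance k \<sigma> xs N x"
    and posterior_variance_le: "posterior_variance k \<sigma> xs N x \<le> k x x"
proof -
  obtain \<beta> where \<beta>: "\<And>x i. i < N \<Longrightarrow> (\<Sum>j<N. k (xs i) (xs j) * \<beta> x j) + \<sigma>\<^sup>2 * \<beta> x i = k x (xs i)"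
    and mean: "\<And>x ys. posterior_mean k \<sigma> xs ys N x = (\<Sum>i<N. \<beta> x i * ys i)"
    and var: "\<And>x. posterior_variance k \<sigma> xs N x = k x x - (\<Sum>i<N. \<beta> x i * k x (xs i))"
    by (rule posterior_weights[OF gram_invertible kernel_sym[OF inputs inputs]]) (rule that, assumption+)
  have "(\<Sum>j<N. k (xs i) (xs j) * \<beta> x j) + \<sigma>\<^sup>2 * \<beta> x i = k x (xs i) - 0 * k x (xs i)" if "i < N" for i
    using \<beta>[OF that] by simp
  from residual_has_gaussian_mgf[OF x x this]
  show "has_gaussian_mgf M (\<lambda>\<omega>. posterior_error N \<omega> x) (posterior_variance k \<sigma> xs N x)"
    "0 \<le> posterior_variance k \<sigma> xs N x" "posterior_variance k \<sigma> xs N x \<le> k x x"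
    by (simp_all add: posterior_error_def mean var)
qed

text \<open>The normal equations are linear in the right-hand side, so the difference of two weight
  vectors is the weight vector of the increment. Dropping the explained variance leaves the prior
  variance, which knows neither \<open>N\<close> nor the inputs.\<close>

lemma posterior_error_increment_has_gaussian_mgf:
  assumes x: "x \<in> X" "x' \<in> X"
  obtains v where "v \<le> k x x - 2 * k x x' + k x' x'"
    "has_gaussian_mgf M (\<lambda>\<omega>. posterior_error N \<omega> x - posterior_error N \<omega> x') v"
proof -
  obtain \<beta> where \<beta>: "\<And>x i. i < N \<Longrightarrow> (\<Sum>j<N. k (xs i) (xs j) * \<beta> x j) + \<sigma>\<^sup>2 * \<beta> x i = k x (xs i)"
    and mean: "\<And>x ys. posterior_mean k \<sigma> xs ys N x = (\<Sum>i<N. \<beta> x i * ys i)"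
    by (rule posterior_weights[OF gram_invertible kernel_sym[OF inputs inputs]]) (rule that, assumption+)
  have eq: "(\<Sum>j<N. k (xs i) (xs j) * (\<beta> x j - \<beta> x' j)) + \<sigma>\<^sup>2 * (\<beta> x i - \<beta> x' i)
      = k x (xs i) - 1 * k x' (xs i)" if "i < N" for i
    using \<beta>[OF that, of x] \<beta>[OF that, of x'] by (simp add: right_diff_distrib sum_subtractf)
  show thesis
  proof (rule that)
    show "has_gaussian_mgf M (\<lambda>\<omega>. posterior_error N \<omega> x - posterior_error N \<omega> x')
        (k x x - 2 * 1 * k x x' + 1\<^sup>2 * k x' x'
          - (\<Sum>i<N. (\<beta> x i - \<beta> x' i) * (k x (xs i) - 1 * k x' (xs i))))"
      using residual_has_gaussian_mgf(1)[OF x eq]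
      by (simp add: posterior_error_def mean left_diff_distrib sum_subtractf algebra_simps)
    show "k x x - 2 * 1 * k x x' + 1\<^sup>2 * k x' x'
          - (\<Sum>i<N. (\<beta> x i - \<beta> x' i) * (k x (xs i) - 1 * k x' (xs i))) \<le> k x x - 2 * k x x' + k x' x'"
      using residual_has_gaussian_mgf(3)[OF x eq] by simp
  qed
qed

end

section \<open>Dyadic chaining\<close>

text \<open>One representative is chosen in every half-open dyadic cube of side 2^-j that meets
  \<open>X\<close>. It has to lie in \<open>X\<close> itself, because the process is controlled only
  there.\<close>

lemma dyadic_nets:
  fixes X :: "(real ^ 'd) set"
  assumes "compact X"
  obtains \<pi> :: "nat \<Rightarrow> real ^ 'd \<Rightarrow> real ^ 'd" and K :: real
  where "0 < K" "\<And>j x. x \<in> X \<Longrightarrow> \<pi> j x \<in> X"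
    "\<And>j x. x \<in> X \<Longrightarrow> dist x (\<pi> j x) \<le> CARD('d) / 2 ^ j"
    "\<And>j. finite (\<pi> j ` X)" "\<And>j. card (\<pi> j ` X) \<le> (K * 2 ^ j) ^ CARD('d)"
proof -
  define cell :: "nat \<Rightarrow> real ^ 'd \<Rightarrow> int ^ 'd"
    where "cell j x = vec_lambda (\<lambda>i. \<lfloor>2 ^ j * vec_nth x i\<rfloor>)" for j x
  define \<pi> where "\<pi> j x = inv_into X (cell j) (cell j x)" for j x
  obtain R where R: "norm x \<le> R" if "x \<in> X" for x
    using compact_imp_bounded[OF assms] by (auto simp: bounded_iff)
  \<comment> \<open>\<open>Suc\<close> ensures that \<open>B\<close> is at least 1, so that the 1 in
    the count of the integers between \<open>- (2 ^ j * B)\<close> and \<open>2 ^ j * B\<close> is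
    absorbed by the factor 3.\<close>
  define B :: nat where "B = Suc (nat \<lceil>R\<rceil>)"
  have B: "norm x \<le> B" if "x \<in> X" for x
    using R[OF that] unfolding B_def by linarith
  define Q where "Q j = {- (2 ^ j * int B)..2 ^ j * int B}" for j
  have cell_X: "cell j ` X \<subseteq> vec_lambda ` (PiE UNIV (\<lambda>_. Q j))" for j
  proof
    fix z assume "z \<in> cell j ` X"
    then obtain x where x: "x \<in> X" and z: "z = cell j x" by auto
    have "vec_nth z i \<in> Q j" for i
    proof -
      have "\<bar>vec_nth x i\<bar> \<le> B"
        using component_le_norm_cart[of x i] B[OF x] by linarith
      then have *: "\<bar>2 ^ j * vec_nth x i\<bar> \<le> 2 ^ j * real B"
        by (simp add: abs_mult mult_left_mono)
      have "- (2 ^ j * real B) \<le> 2 ^ j * vec_nth x i"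
        using * by linarith
      moreover have "2 ^ j * vec_nth x i < 2 ^ j * real B + 1"
        using * by linarith
      ultimately show ?thesis
        unfolding z cell_def Q_def by (simp add: le_floor_iff floor_le_iff)
    qed
    then show "z \<in> vec_lambda ` (PiE UNIV (\<lambda>_. Q j))"
      by (intro image_eqI[of _ _ "vec_nth z"]) auto
  qed
  have fin: "finite (PiE (UNIV :: 'd set) (\<lambda>_. Q j))" for j
    by (intro finite_PiE) (auto simp: Q_def)
  have card: "real (card (PiE (UNIV :: 'd set) (\<lambda>_. Q j))) \<le> (3 * real B * 2 ^ j) ^ CARD('d)" for j
  proof -
    have "real (card (Q j)) = 2 * (2 ^ j * B) + 1"
      by (simp add: Q_def)
    also have "\<dots> \<le> 3 * real B * 2 ^ j"
    proof -
      have "1 \<le> real B * 2 ^ j"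
        using mult_mono[of 1 "real B" 1 "2 ^ j"] by (simp add: B_def)
      then show ?thesis by (simp add: algebra_simps)
    qed
    finally have "real (card (Q j)) ^ CARD('d) \<le> (3 * real B * 2 ^ j) ^ CARD('d)"
      by (intro power_mono) auto
    then show ?thesis
      by (simp add: card_PiE)
  qed
  have fin_cell: "finite (cell j ` X)" for j
    using finite_subset[OF cell_X] fin by blast
  have card_cell: "real (card (cell j ` X)) \<le> (3 * real B * 2 ^ j) ^ CARD('d)" for j
  proof -
    have "card (cell j ` X) \<le> card (vec_lambda ` (PiE (UNIV :: 'd set) (\<lambda>_. Q j)))"
      using fin by (intro card_mono cell_X finite_imageI)
    also have "\<dots> \<le> card (PiE (UNIV :: 'd set) (\<lambda>_. Q j))"
      using fin by (rule card_image_le)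
    finally show ?thesis
      using card[of j] by linarith
  qed
  have image: "\<pi> j ` X = inv_into X (cell j) ` cell j ` X" for j
    by (auto simp: \<pi>_def)
  show thesis
  proof (rule that[of "3 * real B" \<pi>])
    show "0 < 3 * real B" by (simp add: B_def)
  next
    fix j x assume x: "x \<in> X"
    show "\<pi> j x \<in> X"
      unfolding \<pi>_def using x by (intro inv_into_into) auto
    have "cell j (\<pi> j x) = cell j x"
      unfolding \<pi>_def using x by (intro f_inv_into_f) auto
    then have floors: "\<lfloor>2 ^ j * vec_nth (\<pi> j x) i\<rfloor> = \<lfloor>2 ^ j * vec_nth x i\<rfloor>" for i
      by (drule_tac arg_cong[of _ _ "\<lambda>z. vec_nth z i"]) (simp add: cell_def)
    \<comment> \<open>Equal floors bound each coordinate; the Euclidean norm is then bounded by the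
      sum of the coordinates, whence the factor \<open>CARD('d)\<close>.\<close>
    have "\<bar>vec_nth (x - \<pi> j x) i\<bar> \<le> 1 / 2 ^ j" for i
    proof -
      have "\<bar>2 ^ j * vec_nth x i - 2 ^ j * vec_nth (\<pi> j x) i\<bar> \<le> 1"
        using floors[of i] by linarith
      also have "2 ^ j * vec_nth x i - 2 ^ j * vec_nth (\<pi> j x) i = 2 ^ j * vec_nth (x - \<pi> j x) i"
        by (simp add: right_diff_distrib)
      finally show ?thesis
        by (simp add: abs_mult pos_le_divide_eq mult.commute)
    qed
    then have "(\<Sum>i\<in>UNIV. \<bar>vec_nth (x - \<pi> j x) i\<bar>) \<le> (\<Sum>i\<in>(UNIV :: 'd set). 1 / 2 ^ j)"
      by (intro sum_mono)
    then show "dist x (\<pi> j x) \<le> CARD('d) / 2 ^ j"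
      unfolding dist_norm using norm_le_l1_cart[of "x - \<pi> j x"] by simp
  next
    fix j
    show "finite (\<pi> j ` X)"
      unfolding image using fin_cell by simp
    show "card (\<pi> j ` X) \<le> (3 * real B * 2 ^ j) ^ CARD('d)"
      unfolding image using card_image_le[OF fin_cell, of "inv_into X (cell j)" j] card_cell[of j] by linarith
  qed
qed

text \<open>The partial sums along the chain are dominated by a geometric series, and continuity of
  \<open>z\<close> carries the bound to the limit point, which need not belong to any net.\<close>

lemma telescoping_bound:
  fixes z :: "'a :: metric_space \<Rightarrow> real"
  assumes cont: "continuous_on X z" and "x \<in> X" "\<And>j. p j \<in> X" "p \<longlonglongrightarrow> x"
    and r: "0 \<le> r" "r < 1" and step: "\<And>j. J \<le> j \<Longrightarrow> \<bar>z (p j) - z (p (Suc j))\<bar> \<le> r ^ j"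
  shows "\<bar>z x\<bar> \<le> \<bar>z (p J)\<bar> + r ^ J / (1 - r)"
proof -
  have partial: "\<bar>z (p (J + n))\<bar> \<le> \<bar>z (p J)\<bar> + (\<Sum>i<n. r ^ (J + i))" for n
  proof (induction n)
    case (Suc n)
    then show ?case
      using step[of "J + n"] by simp
  qed simp
  have "(\<Sum>i<n. r ^ (J + i)) \<le> r ^ J / (1 - r)" for n
  proof -
    have "(\<Sum>i<n. r ^ (J + i)) = r ^ J * (\<Sum>i<n. r ^ i)"
      by (simp add: power_add sum_distrib_left)
    also have "(\<Sum>i<n. r ^ i) \<le> (\<Sum>i. r ^ i)"
      using r by (intro sum_le_suminf) (auto intro: summable_geometric)
    also have "(\<Sum>i. r ^ i) = 1 / (1 - r)"
      using r by (intro suminf_geometric) auto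
    finally show ?thesis
      using r by (simp add: mult_left_mono)
  qed
  then have "\<bar>z (p (J + n))\<bar> \<le> \<bar>z (p J)\<bar> + r ^ J / (1 - r)" for n
    using partial[of n] by (meson add_left_mono order_trans)
  moreover have "(\<lambda>n. \<bar>z (p (J + n))\<bar>) \<longlonglongrightarrow> \<bar>z x\<bar>"
  proof -
    have "(\<lambda>n. z (p n)) \<longlonglongrightarrow> z x"
      using continuous_on_tendsto_compose[OF cont \<open>p \<longlonglongrightarrow> x\<close> \<open>x \<in> X\<close>] assms(3) by simp
    from LIMSEQ_ignore_initial_segment[OF this, of J] show ?thesis
      by (intro tendsto_rabs) (simp add: add.commute)
  qed
  ultimately show ?thesis
    by (intro LIMSEQ_le_const2) auto
qed

text \<open>Doubly exponential decay beats geometric growth with any base. In the application the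
  growth counts the pairs of net points and the indices N at a level.\<close>

lemma summable_power_mult_exp_neg_power:
  fixes B c q :: real
  assumes "1 < B" "0 < c" "1 < q"
  shows "summable (\<lambda>j. B ^ j * exp (- (c * q ^ j)))"
proof (rule summable_comparison_test_bigo)
  show "summable (\<lambda>j. norm ((1 / 2 :: real) ^ j))"
    by simp
  show "(\<lambda>j. B ^ j * exp (- (c * q ^ j))) \<in> O(\<lambda>j. (1 / 2) ^ j)"
  proof -
    define a b where "a = ln q" and "b = ln B"
    have "0 < a" "0 < b"
      using assms by (simp_all add: a_def b_def)
    then have "(\<lambda>j :: nat. exp (b * j) * exp (- (c * exp (a * j)))) \<in> O(\<lambda>j. (1 / 2) ^ j)"
      using \<open>0 < c\<close> by real_asymp
    then show ?thesis
      using assms by (simp add: a_def b_def exp_of_nat2_mult)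
  qed
qed

text \<open>The lower bound on \<open>2 ^ J N\<close> puts N in the range of indices controlled at
  the levels from \<open>J N\<close> on; the upper bound keeps the net at that level polynomial in
  N.\<close>

lemma dyadic_scale:
  obtains J :: "nat \<Rightarrow> nat" where "\<And>N. 1 \<le> N \<Longrightarrow> N \<le> 2 ^ J N \<and> 2 ^ J N \<le> 2 * N"
proof -
  have "\<exists>j :: nat. N \<le> 2 ^ j \<and> 2 ^ j \<le> 2 * N" if N: "1 \<le> N" for N :: nat
  proof -
    obtain n where "2 ^ n \<le> N" "N < 2 ^ (n + 1)"
      using ex_power_ivl1[of 2 N] N by auto
    then show ?thesis
      by (intro exI[of _ "n + 1"]) auto
  qed
  then show thesis
    using that by metis
qed

lemma powr_minus_in_bigo_ln_powr:
  fixes a b :: real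
  assumes "0 < a"
  shows "(\<lambda>N. real N powr (- a)) \<in> O(\<lambda>N. ln (real N) powr b)"
  using assms by real_asymp

section \<open>Almost sure bounds along the nets\<close>

context prob_space
begin

text \<open>The ratio \<open>3 / 4\<close> of the thresholds is a choice: it is less than 1, so that they are summable, and
  \<open>2 * (3 / 4)\<^sup>2 > 1\<close>, so that they dominate the standard deviations of order \<open>2 powr (- j / 2)\<close>.\<close>

lemma chaining_increments_AE:
  fixes Z :: "nat \<Rightarrow> 'a \<Rightarrow> 'b :: metric_space \<Rightarrow> real" and p :: nat and L D K :: real
  assumes "0 < L" "0 < D" "0 < K"
    and increments: "\<And>N x x'. x \<in> X \<Longrightarrow> x' \<in> X \<Longrightarrow>
      \<exists>v \<le> L * dist x x'. has_gaussian_mgf M (\<lambda>\<omega>. Z N \<omega> x - Z N \<omega> x') v"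
    and net_in: "\<And>j x. x \<in> X \<Longrightarrow> \<pi> j x \<in> X"
    and net_dist: "\<And>j x. x \<in> X \<Longrightarrow> dist x (\<pi> j x) \<le> D / 2 ^ j"
    and net_finite: "\<And>j. finite (\<pi> j ` X)"
    and net_card: "\<And>j. card (\<pi> j ` X) \<le> (K * 2 ^ j) ^ p"
  shows "AE \<omega> in M. \<forall>\<^sub>F j in sequentially. \<forall>N \<le> 2 ^ j. \<forall>x\<in>X.
    \<bar>Z N \<omega> (\<pi> j x) - Z N \<omega> (\<pi> (Suc j) x)\<bar> < (3 / 4) ^ j"
proof -
  \<comment> \<open>Only net points that approximate a common point are linked, so their distance is
    at most \<open>2 * D / 2 ^ j\<close>.\<close>
  define P where "P j = (\<lambda>x. (\<pi> j x, \<pi> (Suc j) x)) ` X" for j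
  define E where "E j N q = {\<omega> \<in> space M. (3 / 4) ^ j \<le> \<bar>Z N \<omega> (fst q) - Z N \<omega> (snd q)\<bar>}" for j N q
  \<comment> \<open>The squared threshold over twice the variance bound
    \<open>L * (2 * D / 2 ^ j)\<close> equals \<open>c * (9 / 8) ^ j\<close>, where 9 / 8 is 2 times
    (3 / 4)^2.\<close>
  define c where "c = 1 / (4 * L * D)"
  have "0 < c"
    using assms by (simp add: c_def)
  have P_sub: "P j \<subseteq> \<pi> j ` X \<times> \<pi> (Suc j) ` X" for j
    by (auto simp: P_def)
  have P_fin: "finite (P j)" for j
    using P_sub net_finite by (meson finite_SigmaI finite_subset)
  have P_card: "real (card (P j)) \<le> (2 * K\<^sup>2 * 4 ^ j) ^ p" for j
  proof -
    have "card (P j) \<le> card (\<pi> j ` X) * card (\<pi> (Suc j) ` X)"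
      using card_mono[OF _ P_sub, of j] net_finite by (simp add: card_cartesian_product)
    then have "real (card (P j)) \<le> real (card (\<pi> j ` X)) * real (card (\<pi> (Suc j) ` X))"
      by (metis of_nat_le_iff of_nat_mult)
    also have "\<dots> \<le> (K * 2 ^ j) ^ p * (K * 2 ^ Suc j) ^ p"
      using \<open>0 < K\<close> by (intro mult_mono net_card) auto
    also have "\<dots> = ((K * 2 ^ j) * (K * 2 ^ Suc j)) ^ p"
      by (simp only: power_mult_distrib)
    also have "(K * 2 ^ j) * (K * 2 ^ Suc j) = 2 * K\<^sup>2 * (2 ^ j * 2 ^ j)"
      by (simp add: power2_eq_square mult_ac)
    also have "(2 :: real) ^ j * 2 ^ j = 4 ^ j"
      by (simp flip: power_mult_distrib)
    finally show ?thesis .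
  qed
  have E: "E j N q \<in> sets M \<and> prob (E j N q) \<le> 2 * exp (- (c * (9 / 8) ^ j))" if q: "q \<in> P j" for j N q
  proof -
    obtain x where x: "x \<in> X" and q: "q = (\<pi> j x, \<pi> (Suc j) x)"
      using q by (auto simp: P_def)
    have "dist (\<pi> j x) (\<pi> (Suc j) x) \<le> dist x (\<pi> j x) + dist x (\<pi> (Suc j) x)"
      using dist_triangle3[of "\<pi> j x" "\<pi> (Suc j) x" x] by simp
    also have "\<dots> \<le> D / 2 ^ j + D / 2 ^ Suc j"
      using x by (intro add_mono net_dist)
    also have "\<dots> \<le> 2 * D / 2 ^ j"
      using \<open>0 < D\<close> by (simp add: field_simps)
    finally have "L * dist (\<pi> j x) (\<pi> (Suc j) x) \<le> L * (2 * D / 2 ^ j)"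
      using \<open>0 < L\<close> by (intro mult_left_mono) auto
    moreover obtain v where "v \<le> L * dist (\<pi> j x) (\<pi> (Suc j) x)"
      and Y: "has_gaussian_mgf M (\<lambda>\<omega>. Z N \<omega> (\<pi> j x) - Z N \<omega> (\<pi> (Suc j) x)) v"
      using increments[OF net_in net_in, OF x x] by blast
    ultimately have v: "v \<le> L * (2 * D / 2 ^ j)"
      by linarith
    have [measurable]: "(\<lambda>\<omega>. Z N \<omega> (\<pi> j x) - Z N \<omega> (\<pi> (Suc j) x)) \<in> borel_measurable M"
      using Y by (simp add: has_gaussian_mgf_def)
    have "prob (E j N q) \<le> 2 * exp (- ((3 / 4) ^ j)\<^sup>2 / (2 * (L * (2 * D / 2 ^ j))))"
      unfolding E_def q fst_conv snd_conv using \<open>0 < L\<close> \<open>0 < D\<close>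
      by (intro has_gaussian_mgf_tail[OF Y v]) auto
    also have "- ((3 / 4) ^ j)\<^sup>2 / (2 * (L * (2 * D / 2 ^ j))) = - (c * (((3 / 4) ^ j)\<^sup>2 * 2 ^ j))"
      using \<open>0 < L\<close> \<open>0 < D\<close> by (simp add: c_def field_simps)
    also have "((3 / 4 :: real) ^ j)\<^sup>2 * 2 ^ j = (9 / 8) ^ j"
      by (simp add: power2_eq_square flip: power_mult_distrib)
    finally show ?thesis
      unfolding E_def q by simp
  qed
  \<comment> \<open>One exceptional event per level, common to all N that may use that level. There
    are \<open>2 ^ j + 1\<close> of these, at most \<open>2 * 2 ^ j\<close>.\<close>
  define A where "A j = (\<Union>N\<in>{..2 ^ j}. \<Union>q\<in>P j. E j N q)" for j :: nat
  have A_sets: "A j \<in> sets M" for j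
    unfolding A_def using E P_fin by (intro sets.finite_UN) auto
  have A_prob: "prob (A j) \<le> 4 * (2 * K\<^sup>2) ^ p * ((2 * 4 ^ p) ^ j * exp (- (c * (9 / 8) ^ j)))" for j
  proof -
    let ?e = "2 * exp (- (c * (9 / 8) ^ j))"
    have inner: "prob (\<Union>q\<in>P j. E j N q) \<le> card (P j) * ?e" for N
    proof -
      have "prob (\<Union>q\<in>P j. E j N q) \<le> (\<Sum>q\<in>P j. prob (E j N q))"
        using E P_fin by (intro finite_measure_subadditive_finite) auto
      also have "\<dots> \<le> card (P j) * ?e"
        using sum_bounded_above[of "P j" "\<lambda>q. prob (E j N q)" ?e] E by simp
      finally show ?thesis .
    qed
    have "prob (A j) \<le> (\<Sum>N\<in>{..2 ^ j}. prob (\<Union>q\<in>P j. E j N q))"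
      unfolding A_def using E P_fin by (intro finite_measure_subadditive_finite) auto
    also have "\<dots> \<le> card {..(2 :: nat) ^ j} * (card (P j) * ?e)"
      using sum_bounded_above[of "{..2 ^ j}" "\<lambda>N. prob (\<Union>q\<in>P j. E j N q)" "card (P j) * ?e"] inner by simp
    also have "\<dots> \<le> (2 * 2 ^ j) * ((2 * K\<^sup>2 * 4 ^ j) ^ p * ?e)"
      using P_card[of j] by (intro mult_mono) auto
    also have "\<dots> = 4 * (2 * K\<^sup>2) ^ p * ((2 * 4 ^ p) ^ j * exp (- (c * (9 / 8) ^ j)))"
      by (simp add: power_mult_distrib mult_ac flip: power_mult)
    finally show ?thesis .
  qed
  have summable: "summable (\<lambda>j. prob (A j))"
  proof (rule summable_comparison_test')
    have "(1 :: real) \<le> 4 ^ p"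
      by (rule one_le_power) simp
    then have "(1 :: real) < 2 * 4 ^ p"
      by linarith
    then show "summable (\<lambda>j. 4 * (2 * K\<^sup>2) ^ p * ((2 * 4 ^ p) ^ j * exp (- (c * (9 / 8) ^ j))))"
      using \<open>0 < c\<close> by (intro summable_mult summable_power_mult_exp_neg_power) auto
    show "norm (prob (A j)) \<le> 4 * (2 * K\<^sup>2) ^ p * ((2 * 4 ^ p) ^ j * exp (- (c * (9 / 8) ^ j)))" for j
      using A_prob[of j] by simp
  qed
  have "AE \<omega> in M. \<forall>\<^sub>F j in sequentially. \<omega> \<in> space M - A j"
    by (intro borel_cantelli_AE1 A_sets summable) (simp add: emeasure_eq_measure)
  then show ?thesis
  proof eventually_elim
    case (elim \<omega>)
    then show ?case
    proof eventually_elim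
      case (elim j)
      show ?case
      proof (intro allI impI ballI)
        fix N :: nat and x assume "N \<le> 2 ^ j" "x \<in> X"
        with elim have "\<omega> \<in> space M" "\<omega> \<notin> E j N (\<pi> j x, \<pi> (Suc j) x)"
          by (auto simp: A_def P_def)
        then show "\<bar>Z N \<omega> (\<pi> j x) - Z N \<omega> (\<pi> (Suc j) x)\<bar> < (3 / 4) ^ j"
          by (simp add: E_def)
      qed
    qed
  qed
qed

text \<open>The net used for N has at most \<open>(2 * K * N) ^ p\<close> points. The factor
  \<open>2 * (p + 2)\<close> in the threshold makes each tail at most
  \<open>2 / N ^ (p + 2)\<close>, so the union bound leaves a multiple of 1 / N^2, which is
  summable.\<close>

lemma chaining_base_AE:
  fixes Z :: "nat \<Rightarrow> 'a \<Rightarrow> 'b :: metric_space \<Rightarrow> real" and p :: nat and K :: real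
  assumes "0 < K"
    and variance: "\<And>N x. N0 \<le> N \<Longrightarrow> x \<in> X \<Longrightarrow>
      0 < b N \<and> (\<exists>v \<le> (b N)\<^sup>2. has_gaussian_mgf M (\<lambda>\<omega>. Z N \<omega> x) v)"
    and net_in: "\<And>j x. x \<in> X \<Longrightarrow> \<pi> j x \<in> X"
    and net_finite: "\<And>j. finite (\<pi> j ` X)"
    and net_card: "\<And>j. card (\<pi> j ` X) \<le> (K * 2 ^ j) ^ p"
    and J: "\<And>N. 1 \<le> N \<Longrightarrow> 2 ^ J N \<le> 2 * N"
  shows "AE \<omega> in M. \<forall>\<^sub>F N in sequentially. \<forall>x\<in>X.
    \<bar>Z N \<omega> (\<pi> (J N) x)\<bar> < b N * sqrt (2 * (p + 2) * ln N)"
proof -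
  define N1 where "N1 = max N0 1"
  define G where "G N = \<pi> (J N) ` X" for N
  have G: "finite (G N)" "u \<in> G N \<Longrightarrow> u \<in> X" for N u
    using net_finite net_in by (auto simp: G_def)
  define E where "E N u = {\<omega> \<in> space M. b N * sqrt (2 * (p + 2) * ln N) \<le> \<bar>Z N \<omega> u\<bar>}" for N u
  \<comment> \<open>Below \<open>N1\<close> neither the measurability of \<open>E N u\<close> nor
    the sign of \<open>b N\<close> is known, so these finitely many events are set to be
    empty.\<close>
  define A where "A N = (if N1 \<le> N then \<Union>u\<in>G N. E N u else {})" for N
  have E: "E N u \<in> sets M \<and> prob (E N u) \<le> 2 / N ^ (p + 2)" if "N1 \<le> N" "u \<in> G N" for N u
  proof -
    have "u \<in> X" "1 \<le> N" "N0 \<le> N"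
      using that G by (auto simp: N1_def)
    then obtain v where "0 < b N" "v \<le> (b N)\<^sup>2" and Y: "has_gaussian_mgf M (\<lambda>\<omega>. Z N \<omega> u) v"
      using variance by blast
    have [measurable]: "(\<lambda>\<omega>. Z N \<omega> u) \<in> borel_measurable M"
      using Y by (simp add: has_gaussian_mgf_def)
    have ln: "0 \<le> ln (real N)"
      using \<open>1 \<le> N\<close> by simp
    have "prob (E N u) \<le> 2 * exp (- (b N * sqrt (2 * (p + 2) * ln N))\<^sup>2 / (2 * (b N)\<^sup>2))"
      unfolding E_def using \<open>0 < b N\<close> ln
      by (intro has_gaussian_mgf_tail[OF Y \<open>v \<le> (b N)\<^sup>2\<close>]) auto
    also have "- (b N * sqrt (2 * (p + 2) * ln N))\<^sup>2 / (2 * (b N)\<^sup>2) = - (real (p + 2) * ln N)"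
      using \<open>0 < b N\<close> ln by (simp add: power_mult_distrib field_simps)
    also have "exp (- (real (p + 2) * ln N)) = 1 / N ^ (p + 2)"
      using \<open>1 \<le> N\<close> by (simp only: exp_minus exp_of_nat_mult) (simp add: inverse_eq_divide)
    finally show ?thesis
      unfolding E_def by simp
  qed
  have A_sets: "A N \<in> sets M" for N
    unfolding A_def using E G by auto
  have A_prob: "prob (A N) \<le> 2 * (2 * K) ^ p * (1 / real N ^ 2)" if "N1 \<le> N" for N
  proof -
    have "1 \<le> N"
      using that by (simp add: N1_def)
    have "prob (A N) \<le> (\<Sum>u\<in>G N. prob (E N u))"
      using E G that by (auto simp: A_def intro!: finite_measure_subadditive_finite)
    also have "\<dots> \<le> card (G N) * (2 / N ^ (p + 2))"
      using sum_bounded_above[of "G N" "\<lambda>u. prob (E N u)" "2 / N ^ (p + 2)"] E that by simp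
    also have "\<dots> \<le> (2 * K * N) ^ p * (2 / N ^ (p + 2))"
    proof (rule mult_right_mono)
      have "K * 2 ^ J N \<le> K * (2 * N)"
        using J[OF \<open>1 \<le> N\<close>] \<open>0 < K\<close> by (intro mult_left_mono) (auto simp flip: of_nat_le_iff[where 'a = real])
      then have "(K * 2 ^ J N) ^ p \<le> (2 * K * N) ^ p"
        using \<open>0 < K\<close> by (intro power_mono) auto
      then show "real (card (G N)) \<le> (2 * K * N) ^ p"
        using net_card[of "J N"] unfolding G_def by linarith
    qed simp
    also have "\<dots> = 2 * (2 * K) ^ p * (1 / real N ^ 2)"
      using \<open>1 \<le> N\<close> by (simp add: power_mult_distrib power_add power2_eq_square)
    finally show ?thesis .
  qed
  have summable: "summable (\<lambda>N. prob (A N))"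
  proof (rule summable_comparison_test')
    show "summable (\<lambda>N. 2 * (2 * K) ^ p * (1 / real N ^ 2))"
      using inverse_power_summable[of 2, where 'a = real]
      by (intro summable_mult) (simp add: inverse_eq_divide power_one_over)
    show "norm (prob (A N)) \<le> 2 * (2 * K) ^ p * (1 / real N ^ 2)" if "N1 \<le> N" for N
      using A_prob[OF that] by simp
  qed
  have "AE \<omega> in M. \<forall>\<^sub>F N in sequentially. \<omega> \<in> space M - A N"
    by (intro borel_cantelli_AE1 A_sets summable) (simp add: emeasure_eq_measure)
  then show ?thesis
  proof eventually_elim
    case (elim \<omega>)
    then show ?case
      using eventually_ge_at_top[of N1]
      by eventually_elim (auto simp: A_def E_def G_def not_le)
  qed
qed

text \<open>For given N the chain starts at level \<open>J N\<close>: the net there contributes the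
  logarithmic term, the finer levels the power of N. The number \<open>a\<close> depends on the
  dimension alone and not on the outcome.\<close>

lemma chaining_sup_AE:
  fixes Z :: "nat \<Rightarrow> 'a \<Rightarrow> real ^ 'd \<Rightarrow> real"
  assumes "compact X" "0 < L"
    and increments: "\<And>N x x'. x \<in> X \<Longrightarrow> x' \<in> X \<Longrightarrow>
      \<exists>v \<le> L * dist x x'. has_gaussian_mgf M (\<lambda>\<omega>. Z N \<omega> x - Z N \<omega> x') v"
    and variance: "\<And>N x. N0 \<le> N \<Longrightarrow> x \<in> X \<Longrightarrow>
      0 < b N \<and> (\<exists>v \<le> (b N)\<^sup>2. has_gaussian_mgf M (\<lambda>\<omega>. Z N \<omega> x) v)"
    and cont: "\<And>N \<omega>. \<omega> \<in> space M \<Longrightarrow> continuous_on X (Z N \<omega>)"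
  shows "\<exists>a>0. AE \<omega> in M. \<forall>\<^sub>F N in sequentially. \<forall>x\<in>X.
      \<bar>Z N \<omega> x\<bar> \<le> b N * sqrt (a * ln N) + 4 * real N powr (- (1 / 3))"
proof -
  obtain \<pi> :: "nat \<Rightarrow> real ^ 'd \<Rightarrow> real ^ 'd" and K :: real
    where "0 < K" and net_in: "\<And>j x. x \<in> X \<Longrightarrow> \<pi> j x \<in> X"
      and net_dist: "\<And>j x. x \<in> X \<Longrightarrow> dist x (\<pi> j x) \<le> CARD('d) / 2 ^ j"
      and net_finite: "\<And>j. finite (\<pi> j ` X)"
      and net_card: "\<And>j. card (\<pi> j ` X) \<le> (K * 2 ^ j) ^ CARD('d)"
    by (rule dyadic_nets[OF \<open>compact X\<close>]) (rule that, assumption+)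
  obtain J :: "nat \<Rightarrow> nat" where J: "\<And>N. 1 \<le> N \<Longrightarrow> N \<le> 2 ^ J N \<and> 2 ^ J N \<le> 2 * N"
    by (rule dyadic_scale) (rule that, assumption)
  define a :: real where "a = real (2 * (CARD('d) + 2))"
  have "AE \<omega> in M. \<forall>\<^sub>F j in sequentially. \<forall>N \<le> 2 ^ j. \<forall>x\<in>X.
      \<bar>Z N \<omega> (\<pi> j x) - Z N \<omega> (\<pi> (Suc j) x)\<bar> < (3 / 4) ^ j"
    using \<open>0 < L\<close> \<open>0 < K\<close>
    by (intro chaining_increments_AE[where D = "CARD('d)", OF _ _ _ increments net_in net_dist net_finite net_card]) auto
  moreover have "AE \<omega> in M. \<forall>\<^sub>F N in sequentially. \<forall>x\<in>X. \<bar>Z N \<omega> (\<pi> (J N) x)\<bar> < b N * sqrt (a * ln N)"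
    unfolding a_def using J
    by (intro chaining_base_AE[OF \<open>0 < K\<close> variance net_in net_finite net_card]) auto
  ultimately have "AE \<omega> in M. \<forall>\<^sub>F N in sequentially. \<forall>x\<in>X.
      \<bar>Z N \<omega> x\<bar> \<le> b N * sqrt (a * ln N) + 4 * real N powr (- (1 / 3))"
    using AE_space
  proof eventually_elim
    case (elim \<omega>)
    from elim(1) obtain j0 where step: "\<bar>Z N \<omega> (\<pi> j x) - Z N \<omega> (\<pi> (Suc j) x)\<bar> < (3 / 4) ^ j"
      if "j0 \<le> j" "N \<le> 2 ^ j" "x \<in> X" for j N x
      unfolding eventually_sequentially by blast
    from elim(2) eventually_gt_at_top[of "2 ^ j0"] show ?case
    proof eventually_elim
      case (elim N)
      have N: "1 \<le> N"
        using elim(2) by (cases N) auto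
      \<comment> \<open>From \<open>2 ^ j0 < N\<close> it follows that every level of the chain for
        N lies beyond the random level \<open>j0\<close> after which the increments are
        small.\<close>
      have "(2 :: nat) ^ j0 < 2 ^ J N"
        using elim(2) J[OF N] by linarith
      then have "j0 < J N"
        by simp
      \<comment> \<open>The exponent 1 / 3 comes from (3 / 4)^3 = 27 / 64, which is at most 1 / 2:
        the cube of the left side is at most 2^-(J N), hence at most 1 / N. The factor 4 of the
        claim is 1 / (1 - 3 / 4).\<close>
      have scale: "(3 / 4 :: real) ^ J N \<le> real N powr (- (1 / 3))"
      proof -
        let ?y = "(3 / 4 :: real) ^ J N"
        have "?y ^ 3 = ((3 / 4) ^ 3) ^ J N"
          by (simp add: mult.commute flip: power_mult)
        also have "\<dots> \<le> (1 / 2) ^ J N"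
          by (intro power_mono) (simp_all add: power3_eq_cube)
        also have "\<dots> \<le> 1 / N"
        proof -
          have "real N \<le> 2 ^ J N"
            using J[OF N] by (metis numeral_power_eq_of_nat_cancel_iff of_nat_le_iff)
          then show ?thesis
            using N by (simp add: power_one_over frac_le)
        qed
        finally have "(?y ^ 3) powr (1 / 3) \<le> (1 / N) powr (1 / 3)"
          by (intro powr_mono2) auto
        moreover have "(?y ^ 3) powr (1 / 3) = ?y"
          by (simp add: powr_powr flip: powr_realpow)
        ultimately show ?thesis
          using N by (simp add: powr_divide powr_minus_divide)
      qed
      show ?case
      proof
        fix x assume x: "x \<in> X"
        have "(\<lambda>j. \<pi> j x) \<longlonglongrightarrow> x"
        proof -
          have "(\<lambda>j. real CARD('d) / 2 ^ j) \<longlonglongrightarrow> 0"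
            by real_asymp
          then have "(\<lambda>j. dist (\<pi> j x) x) \<longlonglongrightarrow> 0"
            by (rule Lim_null_comparison[rotated]) (simp add: dist_commute net_dist x)
          then show ?thesis
            by (rule tendsto_dist_iff[THEN iffD2])
        qed
        moreover have "\<bar>Z N \<omega> (\<pi> j x) - Z N \<omega> (\<pi> (Suc j) x)\<bar> \<le> (3 / 4) ^ j" if "J N \<le> j" for j
        proof -
          have "(2 :: nat) ^ J N \<le> 2 ^ j"
            using that by simp
          then have "N \<le> 2 ^ j"
            using J[OF N] by linarith
          then show ?thesis
            using step[of j N x] that \<open>j0 < J N\<close> x by simp
        qed
        ultimately have "\<bar>Z N \<omega> x\<bar> \<le> \<bar>Z N \<omega> (\<pi> (J N) x)\<bar> + (3 / 4) ^ J N / (1 - 3 / 4)"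
          using cont \<open>\<omega> \<in> space M\<close> x net_in
          by (intro telescoping_bound[where X = X and p = "\<lambda>j. \<pi> j x"]) auto
        also have "\<dots> = \<bar>Z N \<omega> (\<pi> (J N) x)\<bar> + 4 * (3 / 4) ^ J N"
          by simp
        finally show "\<bar>Z N \<omega> x\<bar> \<le> b N * sqrt (a * ln N) + 4 * real N powr (- (1 / 3))"
          using elim(1) x scale by fastforce
      qed
    qed
  qed
  moreover have "0 < a"
    by (simp add: a_def)
  ultimately show ?thesis
    by blast
qed

end

text \<open>The square root from the union bound consumes exactly the exponent 1 / 2 of the assumed
  rate, and a negative power of N is below every power of the logarithm.\<close>

lemma ln_rate_in_bigo:
  fixes C a e :: real
  assumes "0 < C" "0 < a"
  shows "(\<lambda>N. C * ln (real N) powr (- 1 / 2 - e) * sqrt (a * ln (real N)) + 4 * real N powr (- (1 / 3)))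
    \<in> O(\<lambda>N. ln (real N) powr (- e))"
proof (rule sum_in_bigo)
  show "(\<lambda>N. C * ln (real N) powr (- 1 / 2 - e) * sqrt (a * ln (real N))) \<in> O(\<lambda>N. ln (real N) powr (- e))"
  proof (rule bigoI)
    show "\<forall>\<^sub>F N in sequentially. norm (C * ln (real N) powr (- 1 / 2 - e) * sqrt (a * ln (real N)))
        \<le> C * sqrt a * norm (ln (real N) powr (- e))"
      using eventually_gt_at_top[of 1]
    proof eventually_elim
      case (elim N)
      then have "0 < ln (real N)"
        by simp
      then have "ln (real N) powr (- 1 / 2 - e) * sqrt (ln (real N)) = ln (real N) powr (- e)"
        by (simp add: powr_half_sqrt[symmetric] flip: powr_add)
      then show ?case
        using assms \<open>0 < ln (real N)\<close> by (simp add: real_sqrt_mult abs_mult mult_ac)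
    qed
  qed
  show "(\<lambda>N. 4 * real N powr (- (1 / 3))) \<in> O(\<lambda>N. ln (real N) powr (- e))"
    using powr_minus_in_bigo_ln_powr[of "1 / 3" "- e"] by (simp add: landau_o.big.cmult_in_iff)
qed

section \<open>The rate of the posterior error\<close>

text \<open>This replaces a supremum over an uncountable set by a countable one, which is
  measurable. The set where \<open>g\<close> is at most the smaller supremum is closed in
  \<open>X\<close> and contains \<open>D\<close>.\<close>

lemma SUP_eq_SUP_dense:
  fixes g :: "'a :: topological_space \<Rightarrow> real"
  assumes "continuous_on X g" "bdd_above (g ` X)" "D \<subseteq> X" "X \<subseteq> closure D" "X \<noteq> {}"
  shows "(SUP x\<in>X. g x) = (SUP x\<in>D. g x)"
proof (rule antisym)
  have "D \<noteq> {}"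
    using assms by auto
  have bdd: "bdd_above (g ` D)"
    using assms(2,3) by (meson bdd_above_mono image_mono)
  show "(SUP x\<in>D. g x) \<le> (SUP x\<in>X. g x)"
    using \<open>D \<noteq> {}\<close> assms by (intro cSUP_subset_mono) auto
  show "(SUP x\<in>X. g x) \<le> (SUP x\<in>D. g x)"
  proof (rule cSUP_least[OF \<open>X \<noteq> {}\<close>])
    fix x assume "x \<in> X"
    let ?C = "{y \<in> X. g y \<le> (SUP x\<in>D. g x)}"
    have "closedin (top_of_set X) ?C"
      using continuous_closedin_preimage[OF assms(1), of "{..(SUP x\<in>D. g x)}"]
      by (simp add: vimage_def Int_def conj_commute)
    then obtain T where "closed T" and T: "?C = X \<inter> T"
      by (auto simp: closedin_closed)
    have "D \<subseteq> T"
      using T assms(3) cSUP_upper[OF _ bdd] by blast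
    with \<open>closed T\<close> assms(4) \<open>x \<in> X\<close> have "x \<in> T"
      using closure_minimal by blast
    with T \<open>x \<in> X\<close> show "g x \<le> (SUP x\<in>D. g x)"
      by blast
  qed
qed

text \<open>The constant of the Landau symbol may be rounded up to a natural number, which turns the
  event into a countable combination of measurable ones.\<close>

lemma bigo_measurable:
  fixes S :: "nat \<Rightarrow> 'w \<Rightarrow> real" and g :: "nat \<Rightarrow> real"
  assumes [measurable]: "\<And>n. S n \<in> borel_measurable M"
  shows "{\<omega> \<in> space M. (\<lambda>n. S n \<omega>) \<in> O(g)} \<in> sets M"
proof -
  have "(\<lambda>n. S n \<omega>) \<in> O(g) \<longleftrightarrow> (\<exists>c n. \<forall>m\<in>{n..}. \<bar>S m \<omega>\<bar> \<le> real c * \<bar>g m\<bar>)" for \<omega>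
  proof
    assume "(\<lambda>n. S n \<omega>) \<in> O(g)"
    then obtain c n where c: "\<bar>S m \<omega>\<bar> \<le> c * \<bar>g m\<bar>" if "n \<le> m" for m
      by (auto simp: bigo_def eventually_sequentially)
    have "\<bar>S m \<omega>\<bar> \<le> real (nat \<lceil>c\<rceil>) * \<bar>g m\<bar>" if "n \<le> m" for m
      using c[OF that] by (rule order_trans) (intro mult_right_mono, linarith, simp)
    then show "\<exists>c n. \<forall>m\<in>{n..}. \<bar>S m \<omega>\<bar> \<le> real c * \<bar>g m\<bar>"
      by (metis atLeast_iff)
  next
    assume "\<exists>c n. \<forall>m\<in>{n..}. \<bar>S m \<omega>\<bar> \<le> real c * \<bar>g m\<bar>"
    then obtain c n where "\<And>m. n \<le> m \<Longrightarrow> \<bar>S m \<omega>\<bar> \<le> real c * \<bar>g m\<bar>"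
      by (metis atLeast_iff)
    then show "(\<lambda>n. S n \<omega>) \<in> O(g)"
      by (intro bigoI[of _ "real c"]) (auto simp: eventually_sequentially)
  qed
  then show ?thesis
    by simp
qed

theorem theorem3p3:
  fixes M :: "'w measure"
    and X :: "(real ^ 'd) set"
    and k :: "real ^ 'd \<Rightarrow> real ^ 'd \<Rightarrow> real"
    and L\<^sub>k \<sigma>\<^sub>n \<epsilon> \<delta> :: real
    and f :: "'w \<Rightarrow> real ^ 'd \<Rightarrow> real"
    and L\<^sub>f f_bar :: "'w \<Rightarrow> real"
    and xs :: "nat \<Rightarrow> real ^ 'd"
    and noise y :: "nat \<Rightarrow> 'w \<Rightarrow> real"
  assumes "prob_space M"
    and "compact X"
    and "\<And>x x'. 0 < k x x'"
    and "continuous_on (X \<times> X) (\<lambda>(x, x'). k x x')"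
    and "\<And>z. z \<in> X \<Longrightarrow> L\<^sub>k-lipschitz_on X (\<lambda>x. k x z)"
    and "gaussian_process M X (\<lambda>_. 0) k f"
    and "\<And>\<omega>. \<omega> \<in> space M \<Longrightarrow> (L\<^sub>f \<omega>)-lipschitz_on X (f \<omega>)"
    and "\<And>\<omega>. \<omega> \<in> space M \<Longrightarrow> 0 < f_bar \<omega>"
    and "\<And>\<omega> x. \<omega> \<in> space M \<Longrightarrow> x \<in> X \<Longrightarrow> \<bar>f \<omega> x\<bar> \<le> f_bar \<omega>"
    and "0 \<le> \<sigma>\<^sub>n"
    and "prob_space.indep_vars M (\<lambda>_. borel) noise UNIV"
    and "\<And>i. distr M borel (noise i) = gaussian_measure 0 \<sigma>\<^sub>n"
    and "prob_space.indep_set M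
           (sets (vimage_algebra (space M) (\<lambda>\<omega>. \<lambda>x\<in>X. f \<omega> x) (\<Pi>\<^sub>M x\<in>X. borel)))
           (sets (vimage_algebra (space M) (\<lambda>\<omega> i. noise i \<omega>) (\<Pi>\<^sub>M i\<in>UNIV. borel)))"
    and "\<And>i. xs i \<in> X"
    and "\<And>i \<omega>. \<omega> \<in> space M \<Longrightarrow> y i \<omega> = f \<omega> (xs i) + noise i \<omega>"
    and "\<And>N. invertible_mat (noisy_gram k \<sigma>\<^sub>n xs N)"
    and "0 < \<epsilon>"
    and "(\<lambda>N. SUP x\<in>X. posterior_sd k \<sigma>\<^sub>n xs N x) \<in> O(\<lambda>N. ln (real N) powr (- 1 / 2 - \<epsilon>))"
    and "0 < \<delta>" and "\<delta> < 1"
  shows "measure M {\<omega> \<in> space M.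
           (\<lambda>N. SUP x\<in>X. \<bar>posterior_mean k \<sigma>\<^sub>n xs (\<lambda>i. y i \<omega>) N x - f \<omega> x\<bar>)
             \<in> O(\<lambda>N. ln (real N) powr (- \<epsilon>))} \<ge> 1 - \<delta>"
proof -
  interpret gp_regression M X k \<sigma>\<^sub>n f xs noise
    by (intro gp_regression.intro gp_regression_axioms.intro) fact+
  note lipschitz = assms(5)
  have "X \<noteq> {}"
    using inputs by blast
  have Lk: "0 \<le> L\<^sub>k"
    using lipschitz_on_nonneg[OF lipschitz[OF inputs]] .
  have cont: "continuous_on X (posterior_error N \<omega>)" if "\<omega> \<in> space M" for N \<omega>
  proof -
    have "\<exists>w. \<forall>x. posterior_mean k \<sigma>\<^sub>n xs (\<lambda>i. f \<omega> (xs i) + noise i \<omega>) N x = (\<Sum>i<N. w i * k x (xs i))"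
      by (rule posterior_weights[OF gram_invertible kernel_sym[OF inputs inputs]])
    then obtain w where "\<And>x. posterior_mean k \<sigma>\<^sub>n xs (\<lambda>i. f \<omega> (xs i) + noise i \<omega>) N x = (\<Sum>i<N. w i * k x (xs i))"
      by blast
    then have "posterior_error N \<omega> = (\<lambda>x. (\<Sum>i<N. w i * k x (xs i)) - f \<omega> x)"
      by (simp add: posterior_error_def fun_eq_iff)
    moreover have "continuous_on X (\<lambda>x. k x (xs i))" for i
      using lipschitz[OF inputs] by (rule lipschitz_on_continuous_on)
    moreover have "continuous_on X (f \<omega>)"
      using assms(7)[OF that] by (rule lipschitz_on_continuous_on)
    ultimately show ?thesis
      by (simp add: continuous_intros)
  qed
  have bdd_error: "bdd_above ((\<lambda>x. \<bar>posterior_error N \<omega> x\<bar>) ` X)" if "\<omega> \<in> space M" for N \<omega>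
    using compact_continuous_image[OF continuous_on_rabs[OF cont[OF that]] \<open>compact X\<close>]
    by (intro bounded_imp_bdd_above compact_imp_bounded)
  \<comment> \<open>A real supremum dominates the values only if they are bounded above. The prior
    variance provides a bound that serves for every N.\<close>
  have "continuous_on X (\<lambda>x. k x x)"
    using continuous_on_compose2[OF assms(4) continuous_on_Pair[OF continuous_on_id continuous_on_id], of X]
    by auto
  then have "bdd_above ((\<lambda>x. k x x) ` X)"
    using \<open>compact X\<close> by (intro bounded_imp_bdd_above compact_imp_bounded compact_continuous_image)
  then obtain R where R: "k x x \<le> R" if "x \<in> X" for x
    by (auto simp: bdd_above_def)
  have bdd_sd: "bdd_above (posterior_sd k \<sigma>\<^sub>n xs N ` X)" for N
  proof (rule bdd_aboveI2)
    fix x assume "x \<in> X"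
    then show "posterior_sd k \<sigma>\<^sub>n xs N x \<le> sqrt R"
      using posterior_variance_le[of x N] R[of x] by (simp add: posterior_sd_def)
  qed
  obtain C where "0 < C" and C: "\<forall>\<^sub>F N in sequentially.
      norm (SUP x\<in>X. posterior_sd k \<sigma>\<^sub>n xs N x) \<le> C * norm (ln (real N) powr (- 1 / 2 - \<epsilon>))"
    using landau_o.bigE[OF assms(18)] by blast
  define b where "b N = C * ln (real N) powr (- 1 / 2 - \<epsilon>)" for N :: nat
  \<comment> \<open>From 2 on the logarithm is positive, hence so is \<open>b N\<close>, which the
    tail bound needs as a nonzero standard deviation.\<close>
  obtain N0 where N0: "2 \<le> N0" "(SUP x\<in>X. posterior_sd k \<sigma>\<^sub>n xs N x) \<le> b N" if "N0 \<le> N" for N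
  proof -
    from C obtain N1 where N1: "norm (SUP x\<in>X. posterior_sd k \<sigma>\<^sub>n xs N x) \<le> b N" if "N1 \<le> N" for N
      by (auto simp: eventually_sequentially b_def)
    show thesis
      by (rule that[of "max N1 2"]) (use N1 in \<open>force+\<close>)
  qed
  have variance: "0 < b N \<and> (\<exists>v \<le> (b N)\<^sup>2. has_gaussian_mgf M (\<lambda>\<omega>. posterior_error N \<omega> x) v)"
    if "N0 \<le> N" "x \<in> X" for N x
  proof
    show "0 < b N"
      using N0(1)[OF that(1)] that(1) \<open>0 < C\<close> by (simp add: b_def)
    have "sqrt (posterior_variance k \<sigma>\<^sub>n xs N x) \<le> b N"
      using cSUP_upper[OF \<open>x \<in> X\<close> bdd_sd, of N] N0(2)[OF \<open>N0 \<le> N\<close>] by (simp add: posterior_sd_def)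
    then have "posterior_variance k \<sigma>\<^sub>n xs N x \<le> (b N)\<^sup>2"
      by (rule sqrt_le_D)
    then show "\<exists>v \<le> (b N)\<^sup>2. has_gaussian_mgf M (\<lambda>\<omega>. posterior_error N \<omega> x) v"
      using posterior_error_has_gaussian_mgf[OF \<open>x \<in> X\<close>] by blast
  qed
  \<comment> \<open>The Lipschitz constant may be 0, whereas the chaining divides by its constant;
    adding 1 makes it positive.\<close>
  have increments: "\<exists>v \<le> (2 * L\<^sub>k + 1) * dist x x'.
      has_gaussian_mgf M (\<lambda>\<omega>. posterior_error N \<omega> x - posterior_error N \<omega> x') v"
    if x: "x \<in> X" "x' \<in> X" for N x x'
  proof -
    obtain v where v: "v \<le> k x x - 2 * k x x' + k x' x'"
      and mgf: "has_gaussian_mgf M (\<lambda>\<omega>. posterior_error N \<omega> x - posterior_error N \<omega> x') v"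
      by (rule posterior_error_increment_has_gaussian_mgf[OF x])
    \<comment> \<open>By symmetry of the kernel the prior variance of the increment is the sum of
      these two differences, each of which varies the first argument only.\<close>
    have "k x x - k x' x \<le> L\<^sub>k * dist x x'" "k x' x' - k x x' \<le> L\<^sub>k * dist x x'"
      using lipschitz_onD[OF lipschitz[OF x(1)] x] lipschitz_onD[OF lipschitz[OF x(2)] x]
      by (auto simp: dist_real_def abs_le_iff)
    then have "v \<le> 2 * (L\<^sub>k * dist x x')"
      using v kernel_sym[OF x] by linarith
    also have "\<dots> \<le> (2 * L\<^sub>k + 1) * dist x x'"
      by (simp add: distrib_right)
    finally show ?thesis
      using mgf by blast
  qed
  have L: "0 < 2 * L\<^sub>k + 1"
    using Lk by linarith
  have "\<exists>a>0. AE \<omega> in M. \<forall>\<^sub>F N in sequentially. \<forall>x\<in>X.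
      \<bar>posterior_error N \<omega> x\<bar> \<le> b N * sqrt (a * ln N) + 4 * real N powr (- (1 / 3))"
    by (rule chaining_sup_AE[where ?N0.0 = N0, OF \<open>compact X\<close> L increments variance cont])
  then obtain a where "0 < a" and AE_bound: "AE \<omega> in M. \<forall>\<^sub>F N in sequentially. \<forall>x\<in>X.
      \<bar>posterior_error N \<omega> x\<bar> \<le> b N * sqrt (a * ln N) + 4 * real N powr (- (1 / 3))"
    by blast
  define S where "S N \<omega> = (SUP x\<in>X. \<bar>posterior_error N \<omega> x\<bar>)" for N \<omega>
  let ?A = "{\<omega> \<in> space M. (\<lambda>N. S N \<omega>) \<in> O(\<lambda>N. ln (real N) powr (- \<epsilon>))}"
  have "AE \<omega> in M. \<omega> \<in> ?A"
    using AE_bound AE_space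
  proof eventually_elim
    case (elim \<omega>)
    have "(\<lambda>N. S N \<omega>) \<in> O(\<lambda>N. b N * sqrt (a * ln N) + 4 * real N powr (- (1 / 3)))"
    proof (rule bigoI)
      show "\<forall>\<^sub>F N in sequentially. norm (S N \<omega>) \<le> 1 * norm (b N * sqrt (a * ln N) + 4 * real N powr (- (1 / 3)))"
        using elim(1)
      proof eventually_elim
        case (elim N)
        have "S N \<omega> \<le> b N * sqrt (a * ln N) + 4 * real N powr (- (1 / 3))"
          unfolding S_def using elim \<open>X \<noteq> {}\<close> by (intro cSUP_least) auto
        moreover have "0 \<le> S N \<omega>"
          unfolding S_def using cSUP_upper[OF inputs bdd_error[OF \<open>\<omega> \<in> space M\<close>], of N 0]
          by (rule order_trans[rotated]) simp
        ultimately show ?case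
          by simp
      qed
    qed
    also have "(\<lambda>N. b N * sqrt (a * ln N) + 4 * real N powr (- (1 / 3))) \<in> O(\<lambda>N. ln (real N) powr (- \<epsilon>))"
      unfolding b_def by (rule ln_rate_in_bigo) fact+
    finally show ?case
      using elim(2) by simp
  qed
  \<comment> \<open>\<open>measure\<close> is 0 on non-measurable sets, so the almost sure statement
    yields a probability only together with measurability. Continuity of the error reduces the
    supremum to a countable dense subset of \<open>X\<close>.\<close>
  moreover have "?A \<in> events"
  proof -
    obtain D where D: "countable D" "D \<subseteq> X" "X \<subseteq> closure D"
      by (rule separable)
    define T where "T N \<omega> = (SUP x\<in>D. \<bar>posterior_error N \<omega> x\<bar>)" for N \<omega>
    have "S N \<omega> = T N \<omega>" if "\<omega> \<in> space M" for N \<omega>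
      unfolding S_def T_def using that D
      by (intro SUP_eq_SUP_dense continuous_on_rabs cont bdd_error \<open>X \<noteq> {}\<close>)
    then have "?A = {\<omega> \<in> space M. (\<lambda>N. T N \<omega>) \<in> O(\<lambda>N. ln (real N) powr (- \<epsilon>))}"
      by (auto cong: conj_cong)
    moreover have "T N \<in> borel_measurable M" for N
      unfolding T_def[abs_def]
    proof (rule borel_measurable_cSUP)
      fix x assume "x \<in> D"
      then have "(\<lambda>\<omega>. posterior_error N \<omega> x) \<in> borel_measurable M"
        using posterior_error_has_gaussian_mgf[of x N] D(2) by (auto simp: has_gaussian_mgf_def)
      then show "(\<lambda>\<omega>. \<bar>posterior_error N \<omega> x\<bar>) \<in> borel_measurable M"
        by simp
    next
      fix \<omega> assume "\<omega> \<in> space M"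
      then show "bdd_above ((\<lambda>x. \<bar>posterior_error N \<omega> x\<bar>) ` D)"
        by (rule bdd_above_mono[OF bdd_error image_mono[OF D(2)]])
    qed fact
    ultimately show ?thesis
      by (simp add: bigo_measurable)
  qed
  ultimately have "prob ?A = 1"
    by (intro AE_in_set_eq_1[THEN iffD1])
  moreover have "?A = {\<omega> \<in> space M.
      (\<lambda>N. SUP x\<in>X. \<bar>posterior_mean k \<sigma>\<^sub>n xs (\<lambda>i. y i \<omega>) N x - f \<omega> x\<bar>)
        \<in> O(\<lambda>N. ln (real N) powr (- \<epsilon>))}"
    using assms(15) by (auto simp: S_def posterior_error_def)
  ultimately show ?thesis
    using \<open>0 < \<delta>\<close> by simp
qed

end
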